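(* Let $n\in\mathbb{N}$, $n>1$, and let $C<\infty$. There exists a constant $C'\in(0,\infty)$, depending only on $n$ and $C$, such that the following holds. Let $\{h_1,\ldots,h_{2n}\}$ be a family of $\mathcal{C}^1$ functions $h_j:\mathbb{R}^{2n}\to\mathbb{R}$ that has the $L^{3/2}$-$L^3$ property with constant $C$, and define $$\rho_j:\mathbb{R}^{2n+1}\to\mathbb{R}^{2n},\qquad \rho_j(x,t)=(\hat x_j,\,t+h_j(x)),\qquad j=1,\ldots,2n.$$ Then $$\int_{\mathbb{R}^{2n+1}}\prod_{j=1}^{2n}f_j(\rho_j(p))\,dp\leq C'\prod_{j=1}^{2n}\|f_j\|_{\frac{n(2n+1)}{n+1}}$$ for all nonnegative Lebesgue measurable functions $f_1,\ldots,f_{2n}$ on $\mathbb{R}^{2n}$.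
   Context: Points of $\mathbb{R}^{2n+1}$ are written $(x,t)$ with $x=(x_1,\ldots,x_{2n})\in\mathbb{R}^{2n}$, $t\in\mathbb{R}$. $\hat x_j\in\mathbb{R}^{2n-1}$ is obtained from $x$ by deleting the $j$-th coordinate, and $\hat x_{k,n+k}\in\mathbb{R}^{2n-2}$ by deleting the $k$-th and $(n+k)$-th coordinates. Definition ($L^{3/2}$-$L^3$ property, $n>1$). A family $\{h_1,\ldots,h_{2n}\}$ of $\mathcal{C}^1$ functions on $\mathbb{R}^{2n}$ has the $L^{3/2}$-$L^3$ property with constant $C<\infty$ if for all $k=1,\ldots,n$ and every $\hat x_{k,n+k}\in\mathbb{R}^{2n-2}$ (with coordinates $x_i$, $i\in\{1,\ldots,2n\}\setminus\{k,n+k\}$), the operator $$T_{k,\hat x_{k,n+k}}f(x_k,t):=\int_{\mathbb{R}}f\big(x_{n+k},\,t+h_k(x)-h_{n+k}(x)\big)\,dx_{n+k},\qquad f\in\mathcal{C}_c^\infty(\mathbb{R}^2),$$ where $x=(x_1,\ldots,x_k,\ldots,x_{n+k},\ldots,x_{2n})$, satisfies $\|T_{k,\hat x_{k,n+k}}f\|_{L^3(\mathbb{R}^2)}\leq C\|f\|_{L^{3/2}(\mathbb{R}^2)}$ for all $f\in\mathcal{C}_c^\infty(\mathbb{R}^2)$. $\|f_j\|_p\in[0,\infty]$ is the $L^p$ norm with respect to Lebesgue measure on $\mathbb{R}^{2n}$; all integrals are with respect to Lebesgue measure. Convention: $0\cdot\infty=0$. *)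

theory Defs
  imports "HOL-Analysis.Analysis"
begin

text \<open>
  The statement relates the spaces of dimensions \<open>2n - 2\<close>, \<open>2n\<close> and \<open>2n + 1\<close> for one natural
  number \<open>n\<close>, so Euclidean space is modelled on explicit carriers with 1-based coordinates:
  \<open>\<real>\<^sup>I\<close> is the set of extensional functions on the index set \<open>I\<close>, and \<open>\<real>\<^sup>m\<close> is the case
  \<open>I = {1..m}\<close>.  The topology of \<open>\<real>\<^sup>m\<close> is the subspace topology from the product topology of
  \<open>nat \<Rightarrow> real\<close>, which is the Euclidean one.
\<close>

abbreviation coord_space :: "nat set \<Rightarrow> (nat \<Rightarrow> real) set"
  where "coord_space I \<equiv> (\<Pi>\<^sub>E i\<in>I. UNIV)"

definition leb :: "nat \<Rightarrow> (nat \<Rightarrow> real) measure"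
  where "leb m = completion (\<Pi>\<^sub>M i\<in>{1..m}. (lborel :: real measure))"

definition C1_on_space :: "nat \<Rightarrow> ((nat \<Rightarrow> real) \<Rightarrow> real) \<Rightarrow> bool"
  where "C1_on_space m g \<longleftrightarrow>
    (\<exists>D. \<forall>i\<in>{1..m}.
       (\<forall>x\<in>coord_space {1..m}.
          ((\<lambda>s. g (x(i := s))) has_real_derivative D i x) (at (x i))) \<and>
       continuous_on (coord_space {1..m}) (D i))"

text \<open>
  In the next definition \<open>D a b\<close> is the partial derivative of order \<open>a\<close> in the first and \<open>b\<close> in
  the second variable.
\<close>

definition smooth_plane :: "(real \<times> real \<Rightarrow> real) \<Rightarrow> bool"
  where "smooth_plane f \<longleftrightarrow>
    (\<exists>D :: nat \<Rightarrow> nat \<Rightarrow> real \<times> real \<Rightarrow> real.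
       D 0 0 = f \<and>
       (\<forall>a b p. (D a b has_derivative
          (\<lambda>v. D (Suc a) b p * fst v + D a (Suc b) p * snd v)) (at p)))"

definition test_functions :: "(real \<times> real \<Rightarrow> real) set"
  where "test_functions = {f. smooth_plane f \<and> compact (closure {p. f p \<noteq> 0})}"

text \<open>Only exponents \<open>p > 0\<close> are used, for which \<open>\<infinity>\<close> to the power \<open>p\<close> is \<open>\<infinity>\<close>.\<close>

definition ennreal_powr :: "ennreal \<Rightarrow> real \<Rightarrow> ennreal"
  where "ennreal_powr a p = (if a = \<infinity> then \<infinity> else ennreal (enn2real a powr p))"

definition Lp_norm :: "'a measure \<Rightarrow> real \<Rightarrow> ('a \<Rightarrow> ennreal) \<Rightarrow> ennreal"
  where "Lp_norm M p g = ennreal_powr (\<integral>\<^sup>+ x. ennreal_powr (g x) p \<partial>M) (1 / p)"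

text \<open>
  Here \<open>z\<close> is a point of \<open>\<real>\<^bsup>2n - 2\<^esup>\<close>, with coordinates indexed by
  \<open>{1..2n} - {k, n + k}\<close>, and the updates insert the two missing coordinates.
\<close>

definition T_op ::
  "nat \<Rightarrow> (nat \<Rightarrow> (nat \<Rightarrow> real) \<Rightarrow> real) \<Rightarrow> nat \<Rightarrow> (nat \<Rightarrow> real) \<Rightarrow>
    (real \<times> real \<Rightarrow> real) \<Rightarrow> real \<times> real \<Rightarrow> real"
  where "T_op n h k z f = (\<lambda>(u, t). LINT s|lebesgue.
    (let x = z(k := u, n + k := s) in f (s, t + h k x - h (n + k) x)))"

definition L32_L3_property ::
  "nat \<Rightarrow> (nat \<Rightarrow> (nat \<Rightarrow> real) \<Rightarrow> real) \<Rightarrow> ennreal \<Rightarrow> bool"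
  where "L32_L3_property n h C \<longleftrightarrow>
    (\<forall>k\<in>{1..n}. \<forall>z\<in>coord_space ({1..2 * n} - {k, n + k}). \<forall>f\<in>test_functions.
       Lp_norm lebesgue 3 (\<lambda>p. ennreal \<bar>T_op n h k z f p\<bar>)
         \<le> C * Lp_norm lebesgue (3 / 2) (\<lambda>p. ennreal \<bar>f p\<bar>))"

definition delete_coord :: "nat \<Rightarrow> nat \<Rightarrow> (nat \<Rightarrow> real) \<Rightarrow> nat \<Rightarrow> real"
  where "delete_coord m j x = (\<lambda>i\<in>{1..m - 1}. if i < j then x i else x (Suc i))"

text \<open>
  A point \<open>p\<close> of \<open>\<real>\<^bsup>2n + 1\<^esup>\<close> is \<open>(x, t)\<close> with \<open>t\<close> its last coordinate; likewise the last
  coordinate of the value \<open>(x\<^sub>j, t + h\<^sub>j(x))\<close>, where \<open>x\<^sub>j\<close> stands for \<open>x\<close> without its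
  \<open>j\<close>-th coordinate, has index \<open>2n\<close>.
\<close>

definition rho ::
  "nat \<Rightarrow> (nat \<Rightarrow> (nat \<Rightarrow> real) \<Rightarrow> real) \<Rightarrow> nat \<Rightarrow> (nat \<Rightarrow> real) \<Rightarrow> nat \<Rightarrow> real"
  where "rho n h j p =
    (let x = restrict p {1..2 * n}; t = p (2 * n + 1)
     in (delete_coord (2 * n) j x)(2 * n := t + h j x))"

end

theory Submission
  imports Defs
begin

text \<open>
  For fixed values of the other coordinates, pairing \<open>T f\<close> with a function and translating in \<open>t\<close>
  turns the \<open>L\<^bsup>3/2\<^esup>\<close>-\<open>L\<^sup>3\<close> bound into the three-dimensional estimate with exponents \<open>3/2\<close>, first
  for test functions and then, by density, for all nonnegative measurable functions.  Releasing
  one frozen coordinate \<open>x\<^sub>i\<close> at a time adds one function \<open>f\<^sub>i\<close>, which after a translation in \<open>t\<close>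
  does not depend on \<open>x\<^sub>i\<close>: Hoelder's inequality on the slices \<open>x\<^sub>i = s\<close> separates \<open>f\<^sub>i\<close> from the
  rest, the induction hypothesis bounds the rest, and Hoelder's inequality in \<open>s\<close> reassembles
  the norms.  With \<open>m\<close> free coordinates the exponents are \<open>(m + 1)/2\<close> for the two functions of the
  pair \<open>(k, n + k)\<close> and \<open>m + 1\<close> for the others; the geometric mean over \<open>k\<close> at \<open>m = 2n\<close> gives the
  symmetric exponent \<open>n(2n + 1)/(n + 1)\<close>.
\<close>

section \<open>Powers and Hoelder's inequality\<close>

text \<open>Each function is replaced by the power whose integral gives its norm, so that Hoelder's
  inequality becomes bookkeeping of reciprocal exponents (weights). On m free coordinates the
  weights are 2/(m+1), twice, and 1/(m+1); they sum to (m+2)/(m+1). Releasing one coordinate gives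
  the new function the weight 1/(m+2) and multiplies the old weights by (m+1)/(m+2), after which
  they sum to exactly 1: this is what Hoelder in the released variable asks for, and it dictates the
  exponents. The same step raises the constant to a power below 1, and that power is at most
  \<open>C\<close> once \<open>1 \<le> C\<close>. Hence the final constant \<open>max 1 C\<close>,
  which passes unchanged through all releases and through the mean over k. Two measure-theoretic
  obstacles shape the rest. The hypothesis concerns smooth compactly supported functions only; with
  one function of the pair fixed, the form is read as integration against a measure on the plane,
  absolutely continuous with respect to Lebesgue measure, so that almost everywhere approximation is
  enough. And a Lebesgue measurable function composed with \<open>rho\<close> is awkward, so each
  one is replaced by a Borel majorant with the same norm.\<close>

lemma ennreal_powr_0 [simp]: "ennreal_powr 0 p = 0"
  by (simp add: ennreal_powr_def)

lemma ennreal_powr_top [simp]: "ennreal_powr top p = top"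
  by (simp add: ennreal_powr_def)

lemma ennreal_powr_1 [simp]: "ennreal_powr a 1 = a"
  by (cases a) (auto simp: ennreal_powr_def)

lemma ennreal_powr_one_left [simp]: "ennreal_powr 1 p = 1"
  by (simp add: ennreal_powr_def)

lemma ennreal_powr_ennreal: "0 \<le> r \<Longrightarrow> ennreal_powr (ennreal r) p = ennreal (r powr p)"
  by (simp add: ennreal_powr_def)

lemma ennreal_powr_eq_0_iff [simp]: "ennreal_powr a p = 0 \<longleftrightarrow> a = 0"
  by (cases a) (auto simp: ennreal_powr_def)

lemma ennreal_powr_eq_top_iff [simp]: "ennreal_powr a p = top \<longleftrightarrow> a = top"
  by (cases a) (auto simp: ennreal_powr_def)

lemma ennreal_powr_mono: "a \<le> b \<Longrightarrow> 0 \<le> p \<Longrightarrow> ennreal_powr a p \<le> ennreal_powr b p"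
  by (cases a; cases b) (auto simp: ennreal_powr_def ennreal_leI powr_mono2 top_unique)

text \<open>Powers fix \<open>0\<close> and \<open>top\<close> whatever the exponent, so the
  convention \<open>0 * top = 0\<close> makes both sides agree in the degenerate cases.\<close>

lemma ennreal_powr_mult: "ennreal_powr (a * b) p = ennreal_powr a p * ennreal_powr b p"
proof (cases "a = top \<or> b = top")
  case True
  then show ?thesis
    by (auto simp: ennreal_mult_top ennreal_top_mult)
next
  case False
  then show ?thesis
    by (cases a; cases b)
      (auto simp: ennreal_powr_ennreal powr_mult simp flip: ennreal_mult)
qed

lemma ennreal_powr_powr: "ennreal_powr (ennreal_powr a p) q = ennreal_powr a (p * q)"
  by (cases a) (auto simp: ennreal_powr_ennreal powr_powr)

lemma ennreal_powr_add: "ennreal_powr a (p + q) = ennreal_powr a p * ennreal_powr a q"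
  by (cases a) (auto simp: ennreal_powr_ennreal powr_add simp flip: ennreal_mult)

lemma ennreal_powr_sum:
  "finite A \<Longrightarrow> A \<noteq> {} \<Longrightarrow> ennreal_powr a (\<Sum>i\<in>A. p i) = (\<Prod>i\<in>A. ennreal_powr a (p i))"
  by (induction A rule: finite_ne_induct) (auto simp: ennreal_powr_add)

lemma ennreal_powr_prod: "ennreal_powr (\<Prod>i\<in>A. f i) p = (\<Prod>i\<in>A. ennreal_powr (f i) p)"
  by (induction A rule: infinite_finite_induct) (auto simp: ennreal_powr_mult)

lemma borel_measurable_ennreal_powr [measurable]:
  assumes [measurable]: "f \<in> borel_measurable M"
  shows "(\<lambda>x. ennreal_powr (f x) p) \<in> borel_measurable M"
  unfolding ennreal_powr_def by measurable

text \<open>Jensen's inequality for the convex function \<open>exp\<close> at the points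
  \<open>ln (x i)\<close>; a vanishing \<open>x i\<close> has no such point and makes the product
  zero.\<close>

lemma prod_powr_le_sum:
  fixes x a :: "'i \<Rightarrow> real"
  assumes "finite A" "\<And>i. i \<in> A \<Longrightarrow> 0 < a i" "sum a A = 1" "\<And>i. i \<in> A \<Longrightarrow> 0 \<le> x i"
  shows "(\<Prod>i\<in>A. x i powr a i) \<le> (\<Sum>i\<in>A. a i * x i)"
proof (cases "\<exists>i\<in>A. x i = 0")
  case True
  then have "(\<Prod>i\<in>A. x i powr a i) = 0"
    using assms(1) by (auto intro!: prod_zero)
  moreover have "0 \<le> (\<Sum>i\<in>A. a i * x i)"
    using assms by (intro sum_nonneg mult_nonneg_nonneg) (auto intro: less_imp_le)
  ultimately show ?thesis by simp
next
  case False
  with assms(4) have pos: "\<And>i. i \<in> A \<Longrightarrow> 0 < x i"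
    by (metis less_eq_real_def)
  have "(\<Prod>i\<in>A. x i powr a i) = exp (\<Sum>i\<in>A. a i *\<^sub>R ln (x i))"
    using assms(1) pos by (auto simp: exp_sum powr_def intro!: prod.cong) (metis less_irrefl)
  also have "\<dots> \<le> (\<Sum>i\<in>A. a i * exp (ln (x i)))"
  proof (rule convex_on_sum[OF _ _ exp_convex])
    show "A \<noteq> {}" using assms(3) by auto
  qed (use assms in \<open>auto intro: less_imp_le\<close>)
  also have "\<dots> = (\<Sum>i\<in>A. a i * x i)"
    using pos by simp
  finally show ?thesis .
qed

text \<open>A single zero factor would collapse the product by the convention
  \<open>0 * top = 0\<close>.\<close>

lemma ennreal_prod_eq_top:
  fixes f :: "'i \<Rightarrow> ennreal"
  assumes "finite A" "\<And>j. j \<in> A \<Longrightarrow> f j \<noteq> 0" "i \<in> A" "f i = top"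
  shows "prod f A = top"
proof -
  have "prod f A = f i * prod f (A - {i})"
    using assms by (simp add: prod.remove)
  moreover have "prod f (A - {i}) \<noteq> 0"
    using assms by (auto simp: prod_zero_iff)
  ultimately show ?thesis
    using assms by (simp add: ennreal_top_mult)
qed

text \<open>After normalising all integrals to 1, this is the weighted AM-GM inequality integrated.\<close>
lemma nn_integral_prod_powr_le:
  fixes f :: "'i \<Rightarrow> 'a \<Rightarrow> ennreal" and a :: "'i \<Rightarrow> real"
  assumes fin: "finite A" and a: "\<And>i. i \<in> A \<Longrightarrow> 0 < a i" "sum a A = 1"
    and f [measurable]: "\<And>i. i \<in> A \<Longrightarrow> f i \<in> borel_measurable M"
  shows "(\<integral>\<^sup>+x. (\<Prod>i\<in>A. ennreal_powr (f i x) (a i)) \<partial>M)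
    \<le> (\<Prod>i\<in>A. ennreal_powr (\<integral>\<^sup>+x. f i x \<partial>M) (a i))"
proof -
  define I where "I i = (\<integral>\<^sup>+x. f i x \<partial>M)" for i
  \<comment> \<open>The order of the cases follows \<open>0 * top = 0\<close>: one vanishing
    integral makes both sides \<open>0\<close> whatever the others are, so an infinite integral
    forces the right side to be \<open>top\<close> only once all are nonzero.\<close>
  consider (zero) i where "i \<in> A" "I i = 0"
    | (top) i where "\<And>j. j \<in> A \<Longrightarrow> I j \<noteq> 0" "i \<in> A" "I i = top"
    | (fin) "\<And>j. j \<in> A \<Longrightarrow> I j \<noteq> 0" "\<And>j. j \<in> A \<Longrightarrow> I j \<noteq> top"
    by blast
  then show ?thesis
  proof cases
    case zero
    then have "AE x in M. f i x = 0"
      unfolding I_def by (subst (asm) nn_integral_0_iff_AE) auto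
    then have "AE x in M. (\<Prod>i\<in>A. ennreal_powr (f i x) (a i)) = 0"
      by eventually_elim (use zero fin in \<open>auto intro!: prod_zero\<close>)
    then have "(\<integral>\<^sup>+x. (\<Prod>i\<in>A. ennreal_powr (f i x) (a i)) \<partial>M) = (\<integral>\<^sup>+x. 0 \<partial>M)"
      by (rule nn_integral_cong_AE)
    then show ?thesis by simp
  next
    case top
    then have "(\<Prod>i\<in>A. ennreal_powr (I i) (a i)) = top"
      by (intro ennreal_prod_eq_top[OF fin]) auto
    then show ?thesis by (simp add: I_def)
  next
    case fin': fin
    define c where "c i = enn2real (I i)" for i
    have c: "0 < c i" "I i = ennreal (c i)" if "i \<in> A" for i
      using fin'[OF that] by (auto simp: c_def enn2real_positive_iff less_top zero_less_iff_neq_zero)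
    define P where "P = (\<Prod>i\<in>A. c i powr a i)"
    have P: "0 \<le> P" by (auto simp: P_def intro!: prod_nonneg)
    \<comment> \<open>Weighted AM-GM for the quotients \<open>f i x / c i\<close>; \<open>P\<close>
      collects the normalising factors. If some \<open>f i x\<close> is infinite,
      \<open>0 < P\<close> makes the right side infinite.\<close>
    have pw: "(\<Prod>i\<in>A. ennreal_powr (f i x) (a i)) \<le> ennreal P * (\<Sum>i\<in>A. ennreal (a i / c i) * f i x)"
      for x
    proof (cases "\<exists>i\<in>A. f i x = top")
      case True
      then obtain i where i: "i \<in> A" "f i x = top" by blast
      have "ennreal (a i / c i) * f i x = top"
        using i a(1)[OF i(1)] c(1)[OF i(1)] by (simp add: ennreal_mult_top)
      then have "(\<Sum>i\<in>A. ennreal (a i / c i) * f i x) = top"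
        using i fin by (subst sum.remove[of _ i]) auto
      moreover have "0 < P" using c by (auto simp: P_def intro!: prod_pos) (metis less_irrefl)
      ultimately show ?thesis by (simp add: ennreal_mult_top)
    next
      case False
      define r where "r i = enn2real (f i x)" for i
      have r: "f i x = ennreal (r i)" "0 \<le> r i" if "i \<in> A" for i
        using that False by (auto simp: r_def less_top)
      have "r i powr a i = c i powr a i * (r i / c i) powr a i" if "i \<in> A" for i
        using r(2)[OF that] c(1)[OF that] by (simp add: powr_divide)
      then have "(\<Prod>i\<in>A. r i powr a i) = P * (\<Prod>i\<in>A. (r i / c i) powr a i)"
        unfolding P_def prod.distrib[symmetric] by (intro prod.cong) auto
      also have "\<dots> \<le> P * (\<Sum>i\<in>A. a i * (r i / c i))"
        using r c by (intro mult_left_mono P prod_powr_le_sum fin a divide_nonneg_pos) auto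
      finally have *: "(\<Prod>i\<in>A. r i powr a i) \<le> P * (\<Sum>i\<in>A. a i / c i * r i)" by simp
      have "(\<Prod>i\<in>A. ennreal_powr (f i x) (a i)) = ennreal (\<Prod>i\<in>A. r i powr a i)"
        using r by (auto simp: ennreal_powr_ennreal prod_ennreal intro!: prod.cong simp flip: prod_ennreal)
      also have "\<dots> \<le> ennreal (P * (\<Sum>i\<in>A. a i / c i * r i))"
        by (rule ennreal_leI[OF *])
      also have "\<dots> = ennreal P * (\<Sum>i\<in>A. ennreal (a i / c i * r i))"
        using P r a(1) c(1) by (simp add: ennreal_mult' sum_nonneg less_imp_le)
      also have "(\<Sum>i\<in>A. ennreal (a i / c i * r i)) = (\<Sum>i\<in>A. ennreal (a i / c i) * f i x)"
        using r a(1) c(1) by (intro sum.cong refl) (metis ennreal_mult divide_nonneg_pos less_imp_le)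
      finally show ?thesis .
    qed
    have "(\<integral>\<^sup>+x. (\<Prod>i\<in>A. ennreal_powr (f i x) (a i)) \<partial>M)
        \<le> (\<integral>\<^sup>+x. ennreal P * (\<Sum>i\<in>A. ennreal (a i / c i) * f i x) \<partial>M)"
      by (rule nn_integral_mono) (rule pw)
    also have "\<dots> = ennreal P * (\<Sum>i\<in>A. ennreal (a i / c i) * I i)"
      unfolding I_def by (simp add: nn_integral_cmult nn_integral_sum)
    also have "(\<Sum>i\<in>A. ennreal (a i / c i) * I i) = (\<Sum>i\<in>A. ennreal (a i))"
      using c a(1) by (intro sum.cong refl) (metis divide_nonneg_pos ennreal_mult less_imp_le less_irrefl nonzero_eq_divide_eq)
    also have "\<dots> = 1"
      using a by (simp add: sum_ennreal less_imp_le)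
    also have "ennreal P * 1 = (\<Prod>i\<in>A. ennreal_powr (I i) (a i))"
      using c by (auto simp: P_def ennreal_powr_ennreal less_imp_le intro!: prod.cong simp flip: prod_ennreal)
    finally show ?thesis by (simp add: I_def)
  qed
qed

section \<open>Smooth functions\<close>

text \<open>The affine maps inside the flat functions make the class closed under derivatives
  without a composition rule.\<close>
inductive_set smooth_line :: "(real \<Rightarrow> real) set" where
  ident: "(\<lambda>x. x) \<in> smooth_line"
| const: "(\<lambda>x. c) \<in> smooth_line"
| flat: "(\<lambda>x. if 0 < a * x + b then exp (- 1 / (a * x + b)) / (a * x + b) ^ k else 0) \<in> smooth_line"
| add: "f \<in> smooth_line \<Longrightarrow> g \<in> smooth_line \<Longrightarrow> (\<lambda>x. f x + g x) \<in> smooth_line"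
| mult: "f \<in> smooth_line \<Longrightarrow> g \<in> smooth_line \<Longrightarrow> (\<lambda>x. f x * g x) \<in> smooth_line"
| inv: "f \<in> smooth_line \<Longrightarrow> (\<And>x. f x \<noteq> 0) \<Longrightarrow> (\<lambda>x. inverse (f x)) \<in> smooth_line"

text \<open>Differentiation turns the exponent \<open>k\<close> into \<open>k + 1\<close> and
  \<open>k + 2\<close>, which is why all exponents are carried along. At \<open>0\<close> the left
  difference quotient vanishes, and the right one is \<open>x ^ Suc k / exp x\<close> with
  \<open>x = 1 / h\<close>, which tends to \<open>0\<close>.\<close>

lemma flat_has_real_derivative:
  fixes y :: real
  defines "\<beta> \<equiv> \<lambda>k y. if 0 < y then exp (- 1 / y) / y ^ k else 0"
  shows "(\<beta> k has_real_derivative - real k * \<beta> (Suc k) y + \<beta> (Suc (Suc k)) y) (at y)"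
proof -
  consider "0 < y" | "y < 0" | "y = 0" by linarith
  then show ?thesis
  proof cases
    case 1
    have "((\<lambda>y. exp (- 1 / y) / y ^ k) has_real_derivative
        - real k * \<beta> (Suc k) y + \<beta> (Suc (Suc k)) y) (at y)"
      using 1 by (auto intro!: derivative_eq_intros simp: \<beta>_def field_simps)
        (cases k; simp add: field_simps power_add)
    then show ?thesis
      by (rule has_field_derivative_transform_within_open[of _ _ _ "{0<..}"]) (use 1 in \<open>auto simp: \<beta>_def\<close>)
  next
    case 2
    have "((\<lambda>y. 0) has_real_derivative - real k * \<beta> (Suc k) y + \<beta> (Suc (Suc k)) y) (at y)"
      using 2 by (auto simp: \<beta>_def)
    then show ?thesis
      by (rule has_field_derivative_transform_within_open[of _ _ _ "{..<0}"]) (use 2 in \<open>auto simp: \<beta>_def\<close>)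
  next
    case 3
    have "((\<lambda>x::real. x ^ Suc k / exp x) \<longlongrightarrow> 0) at_top"
      by (rule tendsto_power_div_exp_0)
    from filterlim_compose[OF this filterlim_inverse_at_top_right]
    have "((\<lambda>h. inverse h ^ Suc k / exp (inverse h)) \<longlongrightarrow> 0) (at_right (0::real))" .
    moreover have "eventually (\<lambda>h. inverse h ^ Suc k / exp (inverse h) = \<beta> k h / h) (at_right 0)"
      by (auto simp: eventually_at_filter \<beta>_def field_simps exp_minus intro!: eventuallyI)
    ultimately have R: "((\<lambda>h. \<beta> k h / h) \<longlongrightarrow> 0) (at_right 0)"
      by (rule Lim_transform_eventually)
    have "eventually (\<lambda>h. 0 = \<beta> k h / h) (at_left 0)"
      by (auto simp: eventually_at_filter \<beta>_def intro!: eventuallyI)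
    then have L: "((\<lambda>h. \<beta> k h / h) \<longlongrightarrow> 0) (at_left 0)"
      by (rule Lim_transform_eventually[OF tendsto_const])
    show ?thesis
      using filterlim_split_at[OF L R] 3 unfolding DERIV_def by (simp add: \<beta>_def)
  qed
qed

lemma smooth_line_deriv:
  assumes "f \<in> smooth_line"
  shows "\<exists>f'\<in>smooth_line. \<forall>x. (f has_real_derivative f' x) (at x)"
  using assms
proof induction
  case ident
  show ?case
    by (rule bexI[of _ "\<lambda>_. 1"]) (auto intro: smooth_line.intros)
next
  case (const c)
  show ?case
    by (rule bexI[of _ "\<lambda>_. 0"]) (auto intro: smooth_line.intros)
next
  case (flat a b k)
  define \<beta> where "\<beta> k y = (if 0 < y then exp (- 1 / y) / y ^ k else 0)" for k :: nat and y :: real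
  have 1: "(\<lambda>x. \<beta> k (a * x + b)) \<in> smooth_line" for k
    unfolding \<beta>_def by (rule smooth_line.flat)
  have 2: "((\<lambda>x. \<beta> k (a * x + b)) has_real_derivative
      a * ((- real k) * \<beta> (Suc k) (a * x + b) + \<beta> (Suc (Suc k)) (a * x + b))) (at x)" for x
  proof -
    have "(\<beta> k has_real_derivative - real k * \<beta> (Suc k) (a * x + b) + \<beta> (Suc (Suc k)) (a * x + b))
        (at (a * x + b))"
      unfolding \<beta>_def by (rule flat_has_real_derivative)
    moreover have "((\<lambda>x. a * x + b) has_real_derivative a) (at x)"
      by (auto intro!: derivative_eq_intros)
    ultimately show ?thesis
      by (rule DERIV_chain2[THEN DERIV_cong]) simp
  qed
  have "(\<lambda>x. a * ((- real k) * \<beta> (Suc k) (a * x + b) + \<beta> (Suc (Suc k)) (a * x + b))) \<in> smooth_line"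
    by (intro smooth_line.mult smooth_line.add smooth_line.const 1)
  then have "\<exists>f'\<in>smooth_line. \<forall>x. ((\<lambda>x. \<beta> k (a * x + b)) has_real_derivative f' x) (at x)"
    by (rule bexI[rotated, where x = "\<lambda>x. a * ((- real k) * \<beta> (Suc k) (a * x + b) + \<beta> (Suc (Suc k)) (a * x + b))"])
      (intro allI 2)
  then show ?case unfolding \<beta>_def .
next
  case (add f g)
  then obtain f' g' where *: "f' \<in> smooth_line" "g' \<in> smooth_line"
    "\<And>x. (f has_real_derivative f' x) (at x)" "\<And>x. (g has_real_derivative g' x) (at x)" by blast
  show ?case
    by (rule bexI[of _ "\<lambda>x. f' x + g' x"]) (use * in \<open>auto intro: smooth_line.add DERIV_add\<close>)
next
  case (mult f g)
  then obtain f' g' where *: "f' \<in> smooth_line" "g' \<in> smooth_line"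
    "\<And>x. (f has_real_derivative f' x) (at x)" "\<And>x. (g has_real_derivative g' x) (at x)" by blast
  show ?case
    by (rule bexI[of _ "\<lambda>x. f' x * g x + g' x * f x"])
      (use * mult in \<open>auto intro: smooth_line.add smooth_line.mult DERIV_mult\<close>)
next
  case (inv f)
  then obtain f' where *: "f' \<in> smooth_line" "\<And>x. (f has_real_derivative f' x) (at x)" by blast
  \<comment> \<open>The class has neither negation nor powers among its generators, so the
    derivative of the reciprocal is spelled as a product of members.\<close>
  have "(\<lambda>x. (- 1) * (inverse (f x) * f' x * inverse (f x))) \<in> smooth_line"
    using * inv by (intro smooth_line.mult smooth_line.const smooth_line.inv) auto
  moreover have "((\<lambda>x. inverse (f x)) has_real_derivative (- 1) * (inverse (f x) * f' x * inverse (f x))) (at x)" for x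
    using DERIV_inverse'[OF *(2) inv(2)] by simp
  ultimately show ?case
    by (intro bexI[where x = "\<lambda>x. (- 1) * (inverse (f x) * f' x * inverse (f x))"] allI)
qed

text \<open>Derivatives are chosen one after the other; membership in the class is kept as an
  invariant because it supplies the next derivative.\<close>

lemma smooth_line_derivs:
  assumes "f \<in> smooth_line"
  shows "\<exists>A. A 0 = f \<and> (\<forall>n x. (A n has_real_derivative A (Suc n) x) (at x))"
proof -
  have "\<exists>A. \<forall>n. (A n \<in> smooth_line \<and> (n = 0 \<longrightarrow> A n = f)) \<and>
      (\<forall>x. (A n has_real_derivative A (Suc n) x) (at x))"
    by (rule dependent_nat_choice) (use assms smooth_line_deriv in auto)
  then show ?thesis by blast
qed

text \<open>Finite sums of products of one-variable functions have explicit mixed derivatives,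
  products of one-variable derivatives, as the double family in \<open>smooth_plane\<close> wants.
  They also form an algebra, to which the Stone-Weierstrass theorem applies.\<close>

inductive_set smooth_tensors :: "(real \<times> real \<Rightarrow> real) set" where
  tensor: "\<alpha> \<in> smooth_line \<Longrightarrow> \<gamma> \<in> smooth_line \<Longrightarrow> (\<lambda>p. \<alpha> (fst p) * \<gamma> (snd p)) \<in> smooth_tensors"
| add: "f \<in> smooth_tensors \<Longrightarrow> g \<in> smooth_tensors \<Longrightarrow> (\<lambda>p. f p + g p) \<in> smooth_tensors"

lemma smooth_tensors_mult:
  assumes "f \<in> smooth_tensors" "g \<in> smooth_tensors"
  shows "(\<lambda>p. f p * g p) \<in> smooth_tensors"
  using assms
proof (induction f)
  case (tensor \<alpha> \<gamma>)
  from tensor(3) show ?case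
  proof induction
    case (tensor \<alpha>' \<gamma>')
    have "(\<lambda>p. (\<alpha> (fst p) * \<alpha>' (fst p)) * (\<gamma> (snd p) * \<gamma>' (snd p))) \<in> smooth_tensors"
      using tensor tensor.hyps \<open>\<alpha> \<in> smooth_line\<close> \<open>\<gamma> \<in> smooth_line\<close>
      by (intro smooth_tensors.tensor[of "\<lambda>x. \<alpha> x * \<alpha>' x" "\<lambda>x. \<gamma> x * \<gamma>' x"] smooth_line.mult)
    then show ?case by (simp add: mult_ac)
  next
    case (add f g)
    then show ?case
      using smooth_tensors.add by (fastforce simp: distrib_left)
  qed
next
  case (add f g)
  then show ?case
    using smooth_tensors.add by (fastforce simp: distrib_right)
qed

lemma smooth_tensors_smooth:
  assumes "f \<in> smooth_tensors"
  shows "smooth_plane f"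
  using assms
proof induction
  case (tensor \<alpha> \<gamma>)
  obtain A G where A: "A 0 = \<alpha>" "\<And>n x. (A n has_real_derivative A (Suc n) x) (at x)"
    and G: "G 0 = \<gamma>" "\<And>n x. (G n has_real_derivative G (Suc n) x) (at x)"
    using smooth_line_derivs tensor by meson
  have "((\<lambda>p. A a (fst p) * G b (snd p)) has_derivative
      (\<lambda>v. A (Suc a) (fst p) * G b (snd p) * fst v + A a (fst p) * G (Suc b) (snd p) * snd v)) (at p)"
    for a b p
  proof -
    have 1: "((\<lambda>p. A a (fst p)) has_derivative (\<lambda>v. A (Suc a) (fst p) * fst v)) (at p)"
      using has_derivative_compose[OF has_derivative_fst[OF has_derivative_ident]
          A(2)[unfolded has_field_derivative_def]] .
    have 2: "((\<lambda>p. G b (snd p)) has_derivative (\<lambda>v. G (Suc b) (snd p) * snd v)) (at p)"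
      using has_derivative_compose[OF has_derivative_snd[OF has_derivative_ident]
          G(2)[unfolded has_field_derivative_def]] .
    show ?thesis
      by (rule has_derivative_eq_rhs[OF has_derivative_mult[OF 1 2]]) (auto simp: algebra_simps)
  qed
  then show ?case
    unfolding smooth_plane_def
    by (intro exI[of _ "\<lambda>a b p. A a (fst p) * G b (snd p)"]) (auto simp: A G)
next
  case (add f g)
  then obtain D E where D: "D 0 0 = f" "\<And>a b p. (D a b has_derivative
          (\<lambda>v. D (Suc a) b p * fst v + D a (Suc b) p * snd v)) (at p)"
    and E: "E 0 0 = g" "\<And>a b p. (E a b has_derivative
          (\<lambda>v. E (Suc a) b p * fst v + E a (Suc b) p * snd v)) (at p)"
    unfolding smooth_plane_def by blast
  have "((\<lambda>p. D a b p + E a b p) has_derivative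
     (\<lambda>v. (D (Suc a) b p + E (Suc a) b p) * fst v + (D a (Suc b) p + E a (Suc b) p) * snd v)) (at p)"
    for a b p
    by (rule has_derivative_eq_rhs[OF has_derivative_add[OF D(2) E(2)]]) (auto simp: algebra_simps)
  then show ?case
    unfolding smooth_plane_def
    by (intro exI[of _ "\<lambda>a b p. D a b p + E a b p"]) (auto simp: D E)
qed

lemma smooth_plane_continuous: "smooth_plane f \<Longrightarrow> continuous_on UNIV f"
  unfolding smooth_plane_def
  by (metis continuous_at_imp_continuous_on has_derivative_continuous)

text \<open>The quotient \<open>\<sigma>\<close> is a smooth step from 0 to 1 on the unit interval;
  its denominator is positive because \<open>y\<close> and \<open>1 - y\<close> are never both
  nonpositive. A falling step times a rising one is the plateau.\<close>

lemma smooth_line_cutoff: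
  fixes R :: real
  shows "\<exists>\<eta>\<in>smooth_line. \<forall>x. 0 \<le> \<eta> x \<and> \<eta> x \<le> 1 \<and>
    (\<bar>x\<bar> \<le> R \<longrightarrow> \<eta> x = 1) \<and> (R + 1 < \<bar>x\<bar> \<longrightarrow> \<eta> x = 0)"
proof -
  define \<beta> :: "real \<Rightarrow> real" where "\<beta> y = (if 0 < y then exp (- 1 / y) / y ^ 0 else 0)" for y
  define \<sigma> where "\<sigma> y = \<beta> y * inverse (\<beta> y + \<beta> (1 - y))" for y
  have nn: "0 \<le> \<beta> y" for y by (simp add: \<beta>_def)
  have pos: "0 < \<beta> y + \<beta> (1 - y)" for y by (auto simp: \<beta>_def intro: add_pos_pos)
  have aff: "(\<lambda>x. \<sigma> (a * x + b)) \<in> smooth_line" for a b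
  proof -
    have "(\<lambda>x. \<beta> (a * x + b)) \<in> smooth_line" for a b
      unfolding \<beta>_def by (rule smooth_line.flat)
    \<comment> \<open>The argument \<open>1 - y\<close> for \<open>y = a * x + b\<close>, rewritten
      in the affine form that the generator \<open>flat\<close> accepts.\<close>
    moreover have "\<beta> (a * x + b) + \<beta> (- a * x + (1 - b)) \<noteq> 0" for x
    proof -
      have "- a * x + (1 - b) = 1 - (a * x + b)" by simp
      then show ?thesis using pos[of "a * x + b"] by (metis less_irrefl)
    qed
    ultimately have "(\<lambda>x. \<beta> (a * x + b) * inverse (\<beta> (a * x + b) + \<beta> (- a * x + (1 - b)))) \<in> smooth_line"
      by (intro smooth_line.mult smooth_line.inv smooth_line.add)
    then show ?thesis by (simp add: \<sigma>_def algebra_simps)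
  qed
  have \<sigma>01: "0 \<le> \<sigma> y \<and> \<sigma> y \<le> 1" for y
    using nn[of y] nn[of "1 - y"] pos[of y] by (simp add: \<sigma>_def field_simps)
  have \<sigma>1: "\<sigma> y = 1" if "1 \<le> y" for y
    using that by (simp add: \<sigma>_def \<beta>_def)
  have \<sigma>0: "\<sigma> y = 0" if "y \<le> 0" for y
    using that by (simp add: \<sigma>_def \<beta>_def)
  define \<eta> where "\<eta> x = \<sigma> (- 1 * x + (R + 1)) * \<sigma> (1 * x + (R + 1))" for x
  have "\<eta> \<in> smooth_line"
    unfolding \<eta>_def by (intro smooth_line.mult aff)
  moreover have "0 \<le> \<eta> x \<and> \<eta> x \<le> 1" for x
    using \<sigma>01 by (auto simp: \<eta>_def intro: mult_le_one)
  moreover have "\<eta> x = 1" if "\<bar>x\<bar> \<le> R" for x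
    using that by (auto simp: \<eta>_def \<sigma>1)
  moreover have "\<eta> x = 0" if "R + 1 < \<bar>x\<bar>" for x
    using that by (auto simp: \<eta>_def \<sigma>0 abs_if split: if_splits)
  ultimately show ?thesis by blast
qed

section \<open>Density of test functions\<close>

lemma smooth_tensors_const: "(\<lambda>p. c) \<in> smooth_tensors"
  using smooth_tensors.tensor[OF smooth_line.const[of c] smooth_line.const[of 1]] by simp

lemma smooth_tensors_Stone_Weierstrass:
  fixes g :: "real \<times> real \<Rightarrow> real"
  assumes "compact S" "continuous_on S g" "0 < e"
  shows "\<exists>f\<in>smooth_tensors. \<forall>x\<in>S. \<bar>g x - f x\<bar> < e"
proof -
  interpret function_ring_on smooth_tensors S
  proof
    show "continuous_on S f" if "f \<in> smooth_tensors" for f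
      using smooth_plane_continuous[OF smooth_tensors_smooth[OF that]] continuous_on_subset by blast
    show "\<exists>f\<in>smooth_tensors. f x \<noteq> f y" if "x \<noteq> y" for x y
    proof (cases "fst x = fst y")
      case True
      with that have "snd x \<noteq> snd y" by (simp add: prod_eq_iff)
      then show ?thesis
        using smooth_tensors.tensor[OF smooth_line.const[of 1] smooth_line.ident] by (intro bexI) auto
    next
      case False
      then show ?thesis
        using smooth_tensors.tensor[OF smooth_line.ident smooth_line.const[of 1]] by (intro bexI) auto
    qed
  qed (use assms in \<open>auto intro: smooth_tensors.add smooth_tensors_mult smooth_tensors_const\<close>)
  show ?thesis
    using assms by (intro Stone_Weierstrass_basic)
qed

text \<open>A measurable function is almost everywhere a limit of continuous ones. These are clipped
  to the range from 0 to \<open>M\<close>, approximated uniformly on a box by smooth tensors, and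
  cut off. Nonnegativity and the common majorant are what Fatou's lemma and dominated convergence
  will use.\<close>

lemma test_functions_approx:
  fixes F :: "real \<times> real \<Rightarrow> real" and R M :: real
  assumes F: "F \<in> borel_measurable borel" "\<And>p. 0 \<le> F p \<and> F p \<le> M"
    and supp: "\<And>p. F p \<noteq> 0 \<Longrightarrow> \<bar>fst p\<bar> \<le> R \<and> \<bar>snd p\<bar> \<le> R"
  shows "\<exists>f. (\<forall>n. f n \<in> test_functions) \<and>
    (\<forall>n p. 0 \<le> f n p \<and> f n p \<le> (M + 2) * indicator (cbox (- R - 1, - R - 1) (R + 1, R + 1)) p) \<and>
    (AE p in lborel. (\<lambda>n. f n p) \<longlonglongrightarrow> F p)"
proof -
  define B :: "(real \<times> real) set" where "B = cbox (- R - 1, - R - 1) (R + 1, R + 1)"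
  have B: "p \<in> B \<longleftrightarrow> \<bar>fst p\<bar> \<le> R + 1 \<and> \<bar>snd p\<bar> \<le> R + 1" for p
    by (cases p) (auto simp: B_def cbox_Pair_eq)
  have "F measurable_on UNIV"
    using F by (intro lebesgue_measurable_imp_measurable_on_real) (auto intro: measurable_completion)
  then obtain N g where N: "negligible N" and g: "\<And>n. continuous_on UNIV (g n)"
    and lim: "\<And>x. x \<notin> N \<Longrightarrow> (\<lambda>n. g n x) \<longlonglongrightarrow> F x"
    unfolding measurable_on_def by auto
  define G where "G n p = max 0 (min M (g n p))" for n p
  have G: "0 \<le> G n p" "G n p \<le> M" for n p
    using F(2)[of p] by (auto simp: G_def)
  have contG: "continuous_on UNIV (\<lambda>p. G n p + 1 / real (Suc n))" for n
    unfolding G_def by (intro continuous_intros g)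
  have limG: "(\<lambda>n. G n x) \<longlonglongrightarrow> F x" if "x \<notin> N" for x
  proof -
    have "(\<lambda>n. G n x) \<longlonglongrightarrow> max 0 (min M (F x))"
      unfolding G_def by (intro tendsto_intros lim that)
    then show ?thesis using F(2)[of x] by (auto simp: max_def min_def split: if_splits)
  qed
  \<comment> \<open>Raising the target by \<open>1 / real (Suc n)\<close> and approximating within
    the same error keeps \<open>q n\<close> between \<open>G n\<close> and
    \<open>G n + 2 / real (Suc n)\<close>, hence nonnegative; this is the source of
    \<open>M + 2\<close>.\<close>
  have "\<exists>f\<in>smooth_tensors. \<forall>x\<in>B. \<bar>(G n x + 1 / real (Suc n)) - f x\<bar> < 1 / real (Suc n)" for n
    by (rule smooth_tensors_Stone_Weierstrass)
      (use contG in \<open>auto simp: B_def intro: continuous_on_subset compact_cbox\<close>)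
  then obtain q where q: "\<And>n. q n \<in> smooth_tensors"
    "\<And>n x. x \<in> B \<Longrightarrow> \<bar>(G n x + 1 / real (Suc n)) - q n x\<bar> < 1 / real (Suc n)"
    by metis
  obtain \<eta> where \<eta>0: "\<eta> \<in> smooth_line" "\<forall>x. 0 \<le> \<eta> x \<and> \<eta> x \<le> 1 \<and>
      (\<bar>x\<bar> \<le> R \<longrightarrow> \<eta> x = 1) \<and> (R + 1 < \<bar>x\<bar> \<longrightarrow> \<eta> x = 0)"
    using smooth_line_cutoff[of R] by (elim bexE)
  then have \<eta>: "\<eta> \<in> smooth_line" "\<And>x. 0 \<le> \<eta> x \<and> \<eta> x \<le> 1"
    "\<And>x. \<bar>x\<bar> \<le> R \<Longrightarrow> \<eta> x = 1" "\<And>x. R + 1 < \<bar>x\<bar> \<Longrightarrow> \<eta> x = 0" by auto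
  define f where "f n p = (\<eta> (fst p) * \<eta> (snd p)) * q n p" for n p
  have f0: "f n p = 0" if "p \<notin> B" for n p
    using that by (auto simp: B f_def not_le \<eta>(4))
  have qB: "0 \<le> q n p \<and> q n p \<le> G n p + 2 / real (Suc n)" if "p \<in> B" for n p
  proof -
    define e where "e = 1 / real (Suc n)"
    have "\<bar>(G n p + e) - q n p\<bar> < e" "2 / real (Suc n) = 2 * e"
      using q(2)[OF that, of n] by (simp_all add: e_def)
    with G(1)[of n p] show ?thesis by linarith
  qed
  have \<eta>\<eta>: "0 \<le> \<eta> (fst p) * \<eta> (snd p)" "\<eta> (fst p) * \<eta> (snd p) \<le> 1" for p
    using \<eta>(2) by (auto intro: mult_le_one)
  show ?thesis
  proof (intro exI[of _ f] conjI allI)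
    fix n
    have "f n \<in> smooth_tensors"
      unfolding f_def by (intro smooth_tensors_mult smooth_tensors.tensor \<eta> q)
    moreover have "compact (closure {p. f n p \<noteq> 0})"
    proof (rule compact_closure[THEN iffD2])
      have "{p. f n p \<noteq> 0} \<subseteq> B" using f0 by blast
      then show "bounded {p. f n p \<noteq> 0}"
        unfolding B_def using bounded_cbox bounded_subset by blast
    qed
    ultimately show "f n \<in> test_functions"
      by (simp add: test_functions_def smooth_tensors_smooth)
  next
    fix n p
    show "0 \<le> f n p"
      using qB[of p n] \<eta>\<eta>[of p] f0[of p n] by (cases "p \<in> B") (auto simp: f_def)
    show "f n p \<le> (M + 2) * indicator (cbox (- R - 1, - R - 1) (R + 1, R + 1)) p"
    proof (cases "p \<in> B")
      case True
      have "f n p \<le> 1 * q n p"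
        unfolding f_def using qB[OF True, of n] \<eta>\<eta> by (intro mult_right_mono) auto
      also have "\<dots> \<le> M + 2"
      proof -
        have "2 / real (Suc n) \<le> 2" by (simp add: field_simps)
        with qB[OF True, of n] G(2)[of n p] show ?thesis by linarith
      qed
      finally show ?thesis
        using True by (simp add: B_def)
    qed (simp add: f0 flip: B_def)
  next
    have "(\<lambda>n. f n p) \<longlonglongrightarrow> F p" if "p \<notin> N" for p
    proof (cases "p \<in> B")
      case True
      have inv: "(\<lambda>n. c / real (Suc n)) \<longlonglongrightarrow> 0" for c
        using LIMSEQ_Suc[OF lim_const_over_n] .
      have "(\<lambda>n. q n p) \<longlonglongrightarrow> F p"
      proof (rule tendsto_sandwich)
        show "eventually (\<lambda>n. G n p \<le> q n p) sequentially"
          using q(2)[OF True] by (auto simp: abs_less_iff intro!: always_eventually less_imp_le)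
        show "eventually (\<lambda>n. q n p \<le> G n p + 2 / real (Suc n)) sequentially"
          using qB[OF True] by (auto intro!: always_eventually)
        show "(\<lambda>n. G n p + 2 / real (Suc n)) \<longlonglongrightarrow> F p"
          using tendsto_add[OF limG[OF that] inv[of 2]] by simp
      qed (rule limG[OF that])
      from tendsto_mult_left[OF this, of "\<eta> (fst p) * \<eta> (snd p)"]
      have "(\<lambda>n. f n p) \<longlonglongrightarrow> \<eta> (fst p) * \<eta> (snd p) * F p" by (simp add: f_def)
      also have "\<eta> (fst p) * \<eta> (snd p) * F p = F p"
        using supp[of p] \<eta>(3) by (cases "F p = 0") auto
      finally show ?thesis .
    next
      case False
      then have "F p = 0" using supp[of p] by (force simp: B)
      with f0[OF False] show ?thesis by simp
    qed
    moreover have "AE p in lebesgue. p \<notin> N"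
      using N by (simp add: negligible_iff_null_sets AE_not_in)
    ultimately have "AE p in lebesgue. (\<lambda>n. f n p) \<longlonglongrightarrow> F p"
      by (auto elim: eventually_mono)
    then show "AE p in lborel. (\<lambda>n. f n p) \<longlonglongrightarrow> F p"
      by (simp add: AE_completion_iff)
  qed
qed

text \<open>A finite limit makes \<open>u\<close> eventually finite, which reduces the claim to real
  powers; \<open>enn2real\<close> sends \<open>top\<close> to \<open>0\<close> and is not continuous
  there.\<close>

lemma tendsto_ennreal_powr:
  assumes u: "(u \<longlongrightarrow> l) F" and l: "l \<noteq> top" and p: "0 < p"
  shows "((\<lambda>x. ennreal_powr (u x) p) \<longlongrightarrow> ennreal_powr l p) F"
proof -
  obtain r where r: "l = ennreal r" "0 \<le> r" using l by (cases l) auto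
  have "((\<lambda>x. enn2real (u x)) \<longlongrightarrow> r) F"
    using u r by (intro tendsto_enn2real) auto
  then have "((\<lambda>x. enn2real (u x) powr p) \<longlongrightarrow> r powr p) F"
    using p by (intro tendsto_powr' tendsto_const) auto
  then have "((\<lambda>x. ennreal (enn2real (u x) powr p)) \<longlongrightarrow> ennreal (r powr p)) F"
    by (rule tendsto_ennrealI)
  moreover have "eventually (\<lambda>x. ennreal (enn2real (u x) powr p) = ennreal_powr (u x) p) F"
  proof -
    have "eventually (\<lambda>x. u x < top) F"
      using order_tendstoD(2)[OF u, of top] l by (simp add: less_top)
    then show ?thesis by eventually_elim (auto simp: ennreal_powr_def)
  qed
  ultimately show ?thesis
    using r by (simp add: ennreal_powr_ennreal tendsto_cong)
qed

text \<open>The approximants converge almost everywhere for Lebesgue measure, and absolute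
  continuity carries this over to \<open>\<nu>\<close>. Fatou's lemma suffices on the left; on the
  right dominated convergence gives the limit of the norms, and the finiteness of \<open>K\<close>
  keeps multiplication by it continuous.\<close>

lemma nn_integral_le_of_test_functions:
  fixes \<nu> :: "(real \<times> real) measure" and K :: ennreal and r :: real
  assumes sets [measurable_cong]: "sets \<nu> = sets borel"
    and ac: "absolutely_continuous lborel \<nu>"
    and K: "K \<noteq> top" and r: "0 < r"
    and test: "\<And>f. f \<in> test_functions \<Longrightarrow> (\<And>p. 0 \<le> f p) \<Longrightarrow>
      (\<integral>\<^sup>+p. ennreal (f p) \<partial>\<nu>) \<le> K * Lp_norm lborel r (\<lambda>p. ennreal (f p))"
    and F [measurable]: "F \<in> borel_measurable borel"
  shows "(\<integral>\<^sup>+p. F p \<partial>\<nu>) \<le> K * Lp_norm lborel r F"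
proof -
  have bounded: "(\<integral>\<^sup>+p. ennreal (F p) \<partial>\<nu>) \<le> K * Lp_norm lborel r (\<lambda>p. ennreal (F p))"
    if F: "F \<in> borel_measurable borel" "\<And>p. 0 \<le> F p \<and> F p \<le> M"
      "\<And>p. F p \<noteq> 0 \<Longrightarrow> \<bar>fst p\<bar> \<le> R \<and> \<bar>snd p\<bar> \<le> R" for F R M
  proof -
    note F(1)[measurable]
    obtain f where f: "\<And>n. f n \<in> test_functions"
      and f_le: "\<And>n p. 0 \<le> f n p \<and> f n p \<le> (M + 2) * indicator (cbox (- R - 1, - R - 1) (R + 1, R + 1)) p"
      and lim: "AE p in lborel. (\<lambda>n. f n p) \<longlonglongrightarrow> F p"
      using test_functions_approx[OF F] by blast
    have [measurable]: "f n \<in> borel_measurable borel" for n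
      using f[of n] by (intro borel_measurable_continuous_onI smooth_plane_continuous)
        (simp add: test_functions_def)
    have "0 \<le> M" using F(2)[of "(0, 0)"] by linarith
    have "AE p in \<nu>. (\<lambda>n. f n p) \<longlonglongrightarrow> F p"
      by (rule absolutely_continuous_AE[OF _ ac lim]) (simp add: sets)
    then have "AE p in \<nu>. ennreal (F p) = liminf (\<lambda>n. ennreal (f n p))"
      by eventually_elim (metis lim_imp_Liminf tendsto_ennrealI trivial_limit_sequentially)
    then have "(\<integral>\<^sup>+p. ennreal (F p) \<partial>\<nu>) = (\<integral>\<^sup>+p. liminf (\<lambda>n. ennreal (f n p)) \<partial>\<nu>)"
      by (rule nn_integral_cong_AE)
    also have "\<dots> \<le> liminf (\<lambda>n. \<integral>\<^sup>+p. ennreal (f n p) \<partial>\<nu>)"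
      by (rule nn_integral_liminf) measurable
    also have "\<dots> \<le> liminf (\<lambda>n. K * Lp_norm lborel r (\<lambda>p. ennreal (f n p)))"
      using f_le by (intro Liminf_mono always_eventually allI test f) auto
    also have "\<dots> = K * Lp_norm lborel r (\<lambda>p. ennreal (F p))"
    proof (rule lim_imp_Liminf)
      let ?w = "\<lambda>p. ennreal ((M + 2) powr r) * indicator (cbox (- R - 1, - R - 1) (R + 1, R + 1)) p"
      have w: "(\<integral>\<^sup>+p. ?w p \<partial>lborel) < \<infinity>"
        using emeasure_lborel_cbox_finite[of "(- R - 1, - R - 1)" "(R + 1, R + 1)"]
        by (subst nn_integral_cmult_indicator) (simp_all add: ennreal_mult_less_top)
      have bd: "ennreal_powr (ennreal (f n p)) r \<le> ?w p" for n p
      proof (cases "p \<in> cbox (- R - 1, - R - 1) (R + 1, R + 1)")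
        case True
        with f_le[of n p] show ?thesis
          using r by (auto simp: ennreal_powr_ennreal intro!: ennreal_leI powr_mono2)
      next
        case False
        with f_le[of n p] show ?thesis by (auto simp: ennreal_powr_ennreal)
      qed
      have "(\<lambda>n. \<integral>\<^sup>+p. ennreal_powr (ennreal (f n p)) r \<partial>lborel)
          \<longlonglongrightarrow> (\<integral>\<^sup>+p. ennreal_powr (ennreal (F p)) r \<partial>lborel)"
      proof (rule nn_integral_dominated_convergence[where w = ?w])
        show "AE p in lborel. (\<lambda>n. ennreal_powr (ennreal (f n p)) r) \<longlonglongrightarrow> ennreal_powr (ennreal (F p)) r"
          using lim by eventually_elim (use r in \<open>auto intro!: tendsto_ennreal_powr tendsto_ennrealI\<close>)
      qed (use w bd in auto)
      moreover have "(\<integral>\<^sup>+p. ennreal_powr (ennreal (F p)) r \<partial>lborel) \<noteq> top"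
      proof -
        have "ennreal_powr (ennreal (F p)) r \<le> ?w p" for p
        proof (cases "F p = 0")
          case False
          then have "p \<in> cbox (- R - 1, - R - 1) (R + 1, R + 1)"
            using F(3)[of p] by (cases p) (auto simp: cbox_Pair_eq)
          then show ?thesis
            using F(2)[of p] r by (auto simp: ennreal_powr_ennreal intro!: ennreal_leI powr_mono2)
        qed simp
        then have "(\<integral>\<^sup>+p. ennreal_powr (ennreal (F p)) r \<partial>lborel) \<le> (\<integral>\<^sup>+p. ?w p \<partial>lborel)"
          by (rule nn_integral_mono)
        with w show ?thesis by (auto simp: top_unique)
      qed
      ultimately show "(\<lambda>n. K * Lp_norm lborel r (\<lambda>p. ennreal (f n p)))
          \<longlonglongrightarrow> K * Lp_norm lborel r (\<lambda>p. ennreal (F p))"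
        unfolding Lp_norm_def using K r
        by (intro ennreal_tendsto_cmult tendsto_ennreal_powr) (auto simp: less_top)
    qed simp
    finally show ?thesis .
  qed
  \<comment> \<open>Truncation of both range and domain produces functions covered by
    \<open>bounded\<close> that increase to \<open>F\<close>.\<close>
  define G where "G n p = (if \<bar>fst p\<bar> \<le> real n \<and> \<bar>snd p\<bar> \<le> real n
      then enn2real (min (F p) (of_nat n)) else 0)" for n p
  have [measurable]: "fst \<in> borel_measurable (borel :: (real \<times> real) measure)"
      "snd \<in> borel_measurable (borel :: (real \<times> real) measure)"
    by (intro borel_measurable_continuous_onI continuous_intros)+
  have [measurable]: "G n \<in> borel_measurable borel" for n
    unfolding G_def by measurable
  have Gn: "ennreal (G n p) = (if \<bar>fst p\<bar> \<le> real n \<and> \<bar>snd p\<bar> \<le> real n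
      then min (F p) (of_nat n) else 0)" for n p
    by (auto simp: G_def min_less_iff_disj of_nat_less_top intro!: ennreal_enn2real)
  have inc: "incseq (\<lambda>n p. ennreal (G n p))"
    by (auto simp: incseq_def le_fun_def Gn intro!: min.coboundedI2 of_nat_mono)
  have SUP: "(SUP n. ennreal (G n p)) = F p" for p
  proof (rule antisym)
    show "(SUP n. ennreal (G n p)) \<le> F p"
      by (rule SUP_least) (simp add: Gn)
    obtain n0 where n0: "\<bar>fst p\<bar> \<le> real n0" "\<bar>snd p\<bar> \<le> real n0"
      using real_arch_simple[of "max \<bar>fst p\<bar> \<bar>snd p\<bar>"] by auto
    have "min (F p) (of_nat n) \<le> (SUP n. ennreal (G n p))" for n
    proof -
      have "min (F p) (of_nat n) \<le> ennreal (G (max n n0) p)"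
      proof -
        have "real n0 \<le> real (max n n0)" by simp
        with n0 have "\<bar>fst p\<bar> \<le> real (max n n0)" "\<bar>snd p\<bar> \<le> real (max n n0)"
          by linarith+
        then have "ennreal (G (max n n0) p) = min (F p) (of_nat (max n n0))"
          by (simp add: Gn)
        then show ?thesis
          by (simp only: min.mono[OF order_refl of_nat_mono[OF max.cobounded1]])
      qed
      also have "\<dots> \<le> (SUP n. ennreal (G n p))"
        by (rule SUP_upper) simp
      finally show ?thesis .
    qed
    then have "(SUP n. min (F p) (of_nat n)) \<le> (SUP n. ennreal (G n p))"
      by (rule SUP_least)
    moreover have "(SUP n. min (F p) (of_nat n)) = F p"
      by (simp flip: inf_min inf_SUP add: ennreal_SUP_of_nat_eq_top)
    ultimately show "F p \<le> (SUP n. ennreal (G n p))" by simp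
  qed
  have "(\<integral>\<^sup>+p. F p \<partial>\<nu>) = (\<integral>\<^sup>+p. (SUP n. ennreal (G n p)) \<partial>\<nu>)"
    by (simp add: SUP)
  also have "\<dots> = (SUP n. \<integral>\<^sup>+p. ennreal (G n p) \<partial>\<nu>)"
    by (rule nn_integral_monotone_convergence_SUP[OF inc]) measurable
  also have "\<dots> \<le> K * Lp_norm lborel r F"
  proof (rule SUP_least)
    fix n
    have "(\<integral>\<^sup>+p. ennreal (G n p) \<partial>\<nu>) \<le> K * Lp_norm lborel r (\<lambda>p. ennreal (G n p))"
    proof (rule bounded)
      show "0 \<le> G n p \<and> G n p \<le> real n" for p
        by (auto simp: G_def ennreal_of_nat_eq_real_of_nat intro!: enn2real_leI)
      show "\<bar>fst p\<bar> \<le> real n \<and> \<bar>snd p\<bar> \<le> real n" if "G n p \<noteq> 0" for p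
        using that by (auto simp: G_def split: if_splits)
    qed measurable
    also have "\<dots> \<le> K * Lp_norm lborel r F"
      unfolding Lp_norm_def using r
      by (intro mult_left_mono ennreal_powr_mono nn_integral_mono) (auto simp: Gn)
    finally show "(\<integral>\<^sup>+p. ennreal (G n p) \<partial>\<nu>) \<le> K * Lp_norm lborel r F" .
  qed
  finally show ?thesis .
qed

section \<open>The estimate for one pair of coordinates\<close>

lemma nn_integral_powr_mult_le:
  assumes [measurable]: "f \<in> borel_measurable M" "g \<in> borel_measurable M"
    and pq: "0 < p" "0 < q" "p + q = 1"
  shows "(\<integral>\<^sup>+x. ennreal_powr (f x) p * ennreal_powr (g x) q \<partial>M)
    \<le> ennreal_powr (\<integral>\<^sup>+x. f x \<partial>M) p * ennreal_powr (\<integral>\<^sup>+x. g x \<partial>M) q"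
  using nn_integral_prod_powr_le[of "UNIV :: bool set" "\<lambda>b. if b then p else q" "\<lambda>b. if b then f else g" M] pq
  by (simp add: UNIV_bool add.commute mult.commute)

lemma nn_integral_lborel_shift:
  fixes c :: real
  assumes "f \<in> borel_measurable borel"
  shows "(\<integral>\<^sup>+t. f (t + c) \<partial>lborel) = (\<integral>\<^sup>+t. f t \<partial>lborel)"
  using nn_integral_real_affine[OF assms, of 1 c] by (simp add: add.commute)

lemma nn_integral_pair_shift:
  fixes f :: "'a \<times> real \<Rightarrow> ennreal" and c :: "'a \<Rightarrow> real"
  assumes f [measurable]: "f \<in> borel_measurable (M \<Otimes>\<^sub>M lborel)" and [measurable]: "c \<in> borel_measurable M"
  shows "(\<integral>\<^sup>+p. f (fst p, snd p + c (fst p)) \<partial>(M \<Otimes>\<^sub>M lborel)) = (\<integral>\<^sup>+p. f p \<partial>(M \<Otimes>\<^sub>M lborel))"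
proof -
  have "(\<integral>\<^sup>+p. f (fst p, snd p + c (fst p)) \<partial>(M \<Otimes>\<^sub>M lborel))
      = (\<integral>\<^sup>+x. \<integral>\<^sup>+t. f (x, t + c x) \<partial>lborel \<partial>M)"
    by (subst lborel.nn_integral_fst[symmetric]) simp_all
  also have "\<dots> = (\<integral>\<^sup>+x. \<integral>\<^sup>+t. f (x, t) \<partial>lborel \<partial>M)"
  proof (rule nn_integral_cong)
    fix x assume [measurable]: "x \<in> space M"
    show "(\<integral>\<^sup>+t. f (x, t + c x) \<partial>lborel) = (\<integral>\<^sup>+t. f (x, t) \<partial>lborel)"
      by (rule nn_integral_lborel_shift) measurable
  qed
  also have "\<dots> = (\<integral>\<^sup>+p. f p \<partial>(M \<Otimes>\<^sub>M lborel))"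
    by (rule lborel.nn_integral_fst) measurable
  finally show ?thesis .
qed

text \<open>The three-dimensional estimate written for \<open>F\<close> and \<open>G\<close> the
  powers 3/2 of the given functions, so that their \<open>L^{3/2}\<close> norms are integrals to the
  power 2/3. Here \<open>u\<close> and \<open>s\<close> are the coordinates k and n + k: deleting
  coordinate k leaves \<open>s\<close> to \<open>F\<close>, deleting coordinate n + k leaves
  \<open>u\<close> to \<open>G\<close>.\<close>

definition plane_estimate :: "ennreal \<Rightarrow> (real \<times> real \<Rightarrow> real) \<Rightarrow> (real \<times> real \<Rightarrow> real) \<Rightarrow> bool"
  where "plane_estimate C a b \<longleftrightarrow>
    (\<forall>F\<in>borel_measurable (lborel \<Otimes>\<^sub>M lborel). \<forall>G\<in>borel_measurable (lborel \<Otimes>\<^sub>M lborel).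
      (\<integral>\<^sup>+u. \<integral>\<^sup>+s. \<integral>\<^sup>+t. ennreal_powr (F (s, t + a (u, s))) (2 / 3) *
          ennreal_powr (G (u, t + b (u, s))) (2 / 3) \<partial>lborel \<partial>lborel \<partial>lborel)
        \<le> C * (ennreal_powr (\<integral>\<^sup>+p. F p \<partial>(lborel \<Otimes>\<^sub>M lborel)) (2 / 3) *
               ennreal_powr (\<integral>\<^sup>+p. G p \<partial>(lborel \<Otimes>\<^sub>M lborel)) (2 / 3)))"

text \<open>\<open>LINT\<close> is \<open>0\<close> for functions that are not integrable, so
  integrability has to be known before the operator can be read as a nonnegative integral. The
  bounded support of \<open>f\<close> confines \<open>s\<close> to an interval, on which
  \<open>f\<close> is bounded.\<close>

lemma test_function_integrable_line:
  fixes c :: "real \<Rightarrow> real"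
  assumes f: "f \<in> test_functions" and [measurable]: "c \<in> borel_measurable borel"
  shows "integrable lborel (\<lambda>s. f (s, c s))"
proof -
  have cont: "continuous_on UNIV f" and comp: "compact (closure {p. f p \<noteq> 0})"
    using f by (auto simp: test_functions_def smooth_plane_continuous)
  have [measurable]: "f \<in> borel_measurable (borel \<Otimes>\<^sub>M borel)"
    unfolding borel_prod by (rule borel_measurable_continuous_onI[OF cont])
  have "bounded {p. f p \<noteq> 0}"
    using comp by (simp add: compact_closure)
  then obtain R where R: "\<And>p. f p \<noteq> 0 \<Longrightarrow> norm p \<le> R"
    unfolding bounded_iff by blast
  have "bounded (f ` closure {p. f p \<noteq> 0})"
    using comp cont by (meson compact_continuous_image compact_imp_bounded continuous_on_subset subset_UNIV)
  then obtain M0 where M0: "\<And>p. p \<in> closure {p. f p \<noteq> 0} \<Longrightarrow> norm (f p) \<le> M0"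
    unfolding bounded_iff by blast
  have M: "norm (f p) \<le> max M0 0" for p
    using M0[OF subsetD[OF closure_subset]] by (cases "f p = 0") (auto simp: le_max_iff_disj)
  show ?thesis
  proof (rule integrableI_bounded_set[where A = "{- R..R}" and B = "max M0 0"])
    show "AE s in lborel. s \<notin> {- R..R} \<longrightarrow> f (s, c s) = 0"
    proof (intro AE_I2 impI)
      fix s assume "s \<notin> {- R..R}"
      then have "R < norm s" by auto
      also have "\<dots> \<le> norm (s, c s)" by (rule norm_fst_le)
      finally show "f (s, c s) = 0" using R by fastforce
    qed
    show "AE s in lborel. s \<in> {- R..R} \<longrightarrow> norm (f (s, c s)) \<le> max M0 0"
      by (intro AE_I2 impI M)
    show "emeasure lborel {- R..R} < \<infinity>"
      by (simp add: emeasure_lborel_Icc_eq)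
  qed measurable
qed

text \<open>Duality, arranged so that density is used in \<open>F\<close> alone: with
  \<open>G\<close> fixed, the form integrates the power 2/3 of \<open>F\<close> against a measure on
  the plane. For a test function in place of that power it becomes the pairing with the operator, to
  which the hypothesis applies.\<close>

lemma plane_estimateI:
  fixes a b :: "real \<times> real \<Rightarrow> real"
  assumes [measurable]: "a \<in> borel_measurable (lborel \<Otimes>\<^sub>M lborel)" "b \<in> borel_measurable (lborel \<Otimes>\<^sub>M lborel)"
    and C: "1 \<le> C" "C \<noteq> top"
    and test: "\<And>f. f \<in> test_functions \<Longrightarrow>
      Lp_norm lebesgue 3 (\<lambda>(u, t). ennreal \<bar>LINT s|lebesgue. f (s, t + a (u, s) - b (u, s))\<bar>)
        \<le> C * Lp_norm lebesgue (3 / 2) (\<lambda>p. ennreal \<bar>f p\<bar>)"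
  shows "plane_estimate C a b"
  unfolding plane_estimate_def
proof (intro ballI)
  fix F G :: "real \<times> real \<Rightarrow> ennreal"
  assume [measurable]: "F \<in> borel_measurable (lborel \<Otimes>\<^sub>M lborel)" "G \<in> borel_measurable (lborel \<Otimes>\<^sub>M lborel)"
  define L3 where "L3 = (lborel :: real measure) \<Otimes>\<^sub>M ((lborel :: real measure) \<Otimes>\<^sub>M (lborel :: real measure))"
  have L3 [measurable_cong]: "sets L3 = sets (borel \<Otimes>\<^sub>M (borel \<Otimes>\<^sub>M borel))"
    unfolding L3_def by (intro sets_pair_measure_cong) auto
  have L3_iter: "(\<integral>\<^sup>+q. f q \<partial>L3) = (\<integral>\<^sup>+u. \<integral>\<^sup>+s. \<integral>\<^sup>+t. f (u, s, t) \<partial>lborel \<partial>lborel \<partial>lborel)"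
    if [measurable]: "f \<in> borel_measurable L3" for f
  proof -
    have "(\<integral>\<^sup>+q. f q \<partial>L3) = (\<integral>\<^sup>+u. \<integral>\<^sup>+q. f (u, q) \<partial>(lborel \<Otimes>\<^sub>M lborel) \<partial>lborel)"
      using that unfolding L3_def
      by (subst sigma_finite_measure.nn_integral_fst)
        (auto intro: sigma_finite_pair_measure lborel.sigma_finite_measure_axioms)
    also have "\<dots> = (\<integral>\<^sup>+u. \<integral>\<^sup>+s. \<integral>\<^sup>+t. f (u, s, t) \<partial>lborel \<partial>lborel \<partial>lborel)"
      by (intro nn_integral_cong, subst lborel.nn_integral_fst) simp_all
    finally show ?thesis .
  qed
  define w where "w q = ennreal_powr (G (fst q, snd (snd q) + b (fst q, fst (snd q)))) (2 / 3)"
    for q :: "real \<times> real \<times> real"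
  define \<tau> where "\<tau> q = (fst (snd q), snd (snd q) + a (fst q, fst (snd q)))" for q :: "real \<times> real \<times> real"
  have [measurable]: "w \<in> borel_measurable L3" "\<tau> \<in> L3 \<rightarrow>\<^sub>M borel \<Otimes>\<^sub>M borel"
    unfolding w_def \<tau>_def by measurable
  \<comment> \<open>The form as a measure: \<open>w\<close> is the factor that contains
    \<open>G\<close>, and \<open>\<tau>\<close> sends (u, s, t) to the argument of
    \<open>F\<close>.\<close>
  define \<nu> where "\<nu> = distr (density L3 w) (borel \<Otimes>\<^sub>M borel) \<tau>"
  have sets_\<nu> [measurable_cong]: "sets \<nu> = sets (borel \<Otimes>\<^sub>M borel)"
    by (simp add: \<nu>_def)
  have int_\<nu>: "(\<integral>\<^sup>+p. f p \<partial>\<nu>) = (\<integral>\<^sup>+u. \<integral>\<^sup>+s. \<integral>\<^sup>+t.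
      ennreal_powr (G (u, t + b (u, s))) (2 / 3) * f (s, t + a (u, s)) \<partial>lborel \<partial>lborel \<partial>lborel)"
    if [measurable]: "f \<in> borel_measurable (borel \<Otimes>\<^sub>M borel)" for f
    unfolding \<nu>_def
    by (subst nn_integral_distr, simp, simp, subst nn_integral_density, simp, simp, subst L3_iter)
      (simp_all add: w_def \<tau>_def)
  \<comment> \<open>For fixed \<open>u\<close> the shear of the plane by \<open>a (u, s)\<close> in
    direction \<open>t\<close> preserves Lebesgue measure, so preimages of null sets under
    \<open>\<tau>\<close> are null, and the density \<open>w\<close> cannot change this.\<close>
  have ac: "absolutely_continuous lborel \<nu>"
    unfolding absolutely_continuous_def
  proof
    fix N :: "(real \<times> real) set"
    assume N: "N \<in> null_sets lborel"
    then have [measurable]: "N \<in> sets (borel \<Otimes>\<^sub>M borel)"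
      unfolding borel_prod by auto
    have "(\<integral>\<^sup>+s. \<integral>\<^sup>+t. indicator N (s, t + a (u, s)) \<partial>lborel \<partial>lborel) = (0 :: ennreal)" for u
    proof -
      have "(\<integral>\<^sup>+s. \<integral>\<^sup>+t. indicator N (s, t + a (u, s)) \<partial>lborel \<partial>lborel)
          = (\<integral>\<^sup>+s. \<integral>\<^sup>+t. indicator N (s, t) \<partial>lborel \<partial>lborel :: ennreal)"
        by (rule nn_integral_cong, rule nn_integral_lborel_shift) measurable
      also have "\<dots> = (\<integral>\<^sup>+p. indicator N p \<partial>(lborel \<Otimes>\<^sub>M lborel))"
        by (subst lborel.nn_integral_fst[symmetric]) simp_all
      also have "\<dots> = 0"
        using N by (simp add: lborel_prod null_sets_def)
      finally show ?thesis .
    qed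
    then have "(\<integral>\<^sup>+q. indicator N (\<tau> q) \<partial>L3) = (0 :: ennreal)"
      by (subst L3_iter) (simp_all add: \<tau>_def)
    then have "AE q in L3. indicator N (\<tau> q) = (0 :: ennreal)"
      by (subst (asm) nn_integral_0_iff_AE) auto
    then have "(\<integral>\<^sup>+q. w q * indicator N (\<tau> q) \<partial>L3) = 0"
      by (subst nn_integral_0_iff_AE) (auto elim: eventually_mono)
    moreover have "(\<integral>\<^sup>+p. indicator N p \<partial>\<nu>) = (\<integral>\<^sup>+q. w q * indicator N (\<tau> q) \<partial>L3)"
      unfolding \<nu>_def
      by (subst nn_integral_distr, simp, simp, subst nn_integral_density, simp_all)
    ultimately show "N \<in> null_sets \<nu>"
      by (simp add: null_sets_def sets_\<nu>)
  qed
  define IF IG where "IF = (\<integral>\<^sup>+p. F p \<partial>(lborel \<Otimes>\<^sub>M lborel))" and "IG = (\<integral>\<^sup>+p. G p \<partial>(lborel \<Otimes>\<^sub>M lborel))"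
  have norm_F: "Lp_norm lborel (3 / 2) (\<lambda>p. ennreal_powr (F p) (2 / 3)) = ennreal_powr IF (2 / 3)"
    by (simp add: Lp_norm_def ennreal_powr_powr IF_def lborel_prod)
  have "(\<integral>\<^sup>+p. ennreal_powr (F p) (2 / 3) \<partial>\<nu>) \<le> C * (ennreal_powr IF (2 / 3) * ennreal_powr IG (2 / 3))"
  \<comment> \<open>The density argument wants a finite constant. If \<open>IG\<close> is infinite,
    the right side is infinite because \<open>1 \<le> C\<close>, unless \<open>IF = 0\<close>; then
    \<open>F\<close> vanishes almost everywhere for \<open>\<nu>\<close> and the left side is
    \<open>0\<close>.\<close>
  proof (cases "IG = top")
    case True
    show ?thesis
    proof (cases "IF = 0")
      case True
      then have "AE p in lborel. F p = 0"
        unfolding IF_def lborel_prod by (subst (asm) nn_integral_0_iff_AE) (auto simp: borel_prod[symmetric])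
      then have "AE p in \<nu>. F p = 0"
        by (rule absolutely_continuous_AE[OF _ ac, rotated]) (simp only: sets_\<nu> borel_prod sets_lborel)
      then have "(\<integral>\<^sup>+p. ennreal_powr (F p) (2 / 3) \<partial>\<nu>) = 0"
        by (subst nn_integral_0_iff_AE) (auto elim: eventually_mono)
      then show ?thesis by simp
    next
      case False
      with True C show ?thesis
        by (auto simp: ennreal_mult_top)
    qed
  next
    case False
    have "(\<integral>\<^sup>+p. ennreal_powr (F p) (2 / 3) \<partial>\<nu>)
        \<le> (C * ennreal_powr IG (2 / 3)) * Lp_norm lborel (3 / 2) (\<lambda>p. ennreal_powr (F p) (2 / 3))"
    proof (rule nn_integral_le_of_test_functions)
      show "sets \<nu> = sets borel" by (simp only: sets_\<nu> borel_prod sets_lborel)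
      show "C * ennreal_powr IG (2 / 3) \<noteq> top"
        using C False by (simp add: ennreal_mult_eq_top_iff)
      show "(\<lambda>p. ennreal_powr (F p) (2 / 3)) \<in> borel_measurable borel"
        unfolding borel_prod[symmetric] by measurable
    next
      fix f assume f: "f \<in> test_functions" and nn: "\<And>p. 0 \<le> f p"
      have [measurable]: "f \<in> borel_measurable (borel \<Otimes>\<^sub>M borel)"
        using f unfolding borel_prod test_functions_def
        by (auto intro!: borel_measurable_continuous_onI smooth_plane_continuous)
      define T where "T p = (\<integral>\<^sup>+s. ennreal (f (s, snd p + a (fst p, s) - b (fst p, s))) \<partial>lborel)" for p
      have [measurable]: "T \<in> borel_measurable (lborel \<Otimes>\<^sub>M lborel)"
        unfolding T_def by measurable
      have T: "ennreal \<bar>LINT s|lebesgue. f (s, t + a (u, s) - b (u, s))\<bar> = T (u, t)" for u t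
      proof -
        have "integrable lborel (\<lambda>s. f (s, t + a (u, s) - b (u, s)))"
          by (rule test_function_integrable_line[OF f, of "\<lambda>s. t + a (u, s) - b (u, s)"]) measurable
        then show ?thesis
          using nn by (simp add: T_def integral_completion nn_integral_eq_integral)
      qed
      have "(\<integral>\<^sup>+p. ennreal (f p) \<partial>\<nu>) = (\<integral>\<^sup>+u. \<integral>\<^sup>+s. \<integral>\<^sup>+t.
          ennreal_powr (G (u, t + b (u, s))) (2 / 3) * ennreal (f (s, t + a (u, s))) \<partial>lborel \<partial>lborel \<partial>lborel)"
        by (rule int_\<nu>) measurable
      also have "\<dots> = (\<integral>\<^sup>+u. \<integral>\<^sup>+s. \<integral>\<^sup>+t.
          ennreal_powr (G (u, t)) (2 / 3) * ennreal (f (s, t + a (u, s) - b (u, s))) \<partial>lborel \<partial>lborel \<partial>lborel)"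
      proof (rule nn_integral_cong, rule nn_integral_cong)
        fix u s
        show "(\<integral>\<^sup>+t. ennreal_powr (G (u, t + b (u, s))) (2 / 3) * ennreal (f (s, t + a (u, s))) \<partial>lborel)
          = (\<integral>\<^sup>+t. ennreal_powr (G (u, t)) (2 / 3) * ennreal (f (s, t + a (u, s) - b (u, s))) \<partial>lborel)"
          using nn_integral_lborel_shift[of "\<lambda>t. ennreal_powr (G (u, t)) (2 / 3)
            * ennreal (f (s, t + a (u, s) - b (u, s)))" "b (u, s)"]
          by (simp add: algebra_simps)
      qed
      also have "\<dots> = (\<integral>\<^sup>+u. \<integral>\<^sup>+t. \<integral>\<^sup>+s.
          ennreal_powr (G (u, t)) (2 / 3) * ennreal (f (s, t + a (u, s) - b (u, s))) \<partial>lborel \<partial>lborel \<partial>lborel)"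
        by (rule nn_integral_cong, rule lborel_pair.Fubini') measurable
      also have "\<dots> = (\<integral>\<^sup>+u. \<integral>\<^sup>+t. ennreal_powr (G (u, t)) (2 / 3) * T (u, t) \<partial>lborel \<partial>lborel)"
        unfolding T_def by (simp add: nn_integral_cmult)
      \<comment> \<open>Writing \<open>T p\<close> as the cube root of its cube lets Hoelder act
        with weights 2/3 and 1/3, which produces the \<open>L^3\<close> norm of
        \<open>T\<close>.\<close>
      also have "\<dots> = (\<integral>\<^sup>+p. ennreal_powr (G p) (2 / 3) * ennreal_powr (ennreal_powr (T p) 3) (1 / 3)
          \<partial>(lborel \<Otimes>\<^sub>M lborel))"
        by (subst lborel.nn_integral_fst[symmetric]) (simp_all add: ennreal_powr_powr)
      also have "\<dots> \<le> ennreal_powr IG (2 / 3) *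
          ennreal_powr (\<integral>\<^sup>+p. ennreal_powr (T p) 3 \<partial>(lborel \<Otimes>\<^sub>M lborel)) (1 / 3)"
        unfolding IG_def by (rule nn_integral_powr_mult_le) auto
      also have "ennreal_powr (\<integral>\<^sup>+p. ennreal_powr (T p) 3 \<partial>(lborel \<Otimes>\<^sub>M lborel)) (1 / 3)
          = Lp_norm lebesgue 3 (\<lambda>(u, t). ennreal \<bar>LINT s|lebesgue. f (s, t + a (u, s) - b (u, s))\<bar>)"
        by (simp add: Lp_norm_def T nn_integral_completion lborel_prod)
      also have "ennreal_powr IG (2 / 3) * \<dots>
          \<le> ennreal_powr IG (2 / 3) * (C * Lp_norm lebesgue (3 / 2) (\<lambda>p. ennreal \<bar>f p\<bar>))"
        by (intro mult_left_mono test f) simp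
      also have "\<dots> = C * ennreal_powr IG (2 / 3) * Lp_norm lborel (3 / 2) (\<lambda>p. ennreal (f p))"
        using nn by (simp add: Lp_norm_def nn_integral_completion mult_ac)
      finally show "(\<integral>\<^sup>+p. ennreal (f p) \<partial>\<nu>)
          \<le> C * ennreal_powr IG (2 / 3) * Lp_norm lborel (3 / 2) (\<lambda>p. ennreal (f p))" .
    qed (use ac in auto)
    then show ?thesis by (simp add: norm_F mult_ac)
  qed
  also have "(\<integral>\<^sup>+p. ennreal_powr (F p) (2 / 3) \<partial>\<nu>) = (\<integral>\<^sup>+u. \<integral>\<^sup>+s. \<integral>\<^sup>+t. ennreal_powr (F (s, t + a (u, s))) (2 / 3) *
          ennreal_powr (G (u, t + b (u, s))) (2 / 3) \<partial>lborel \<partial>lborel \<partial>lborel)"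
    by (subst int_\<nu>) (simp_all add: mult.commute)
  finally show "(\<integral>\<^sup>+u. \<integral>\<^sup>+s. \<integral>\<^sup>+t. ennreal_powr (F (s, t + a (u, s))) (2 / 3) *
          ennreal_powr (G (u, t + b (u, s))) (2 / 3) \<partial>lborel \<partial>lborel \<partial>lborel)
        \<le> C * (ennreal_powr (\<integral>\<^sup>+p. F p \<partial>(lborel \<Otimes>\<^sub>M lborel)) (2 / 3) *
               ennreal_powr (\<integral>\<^sup>+p. G p \<partial>(lborel \<Otimes>\<^sub>M lborel)) (2 / 3))"
    by (simp only: IF_def IG_def)
qed

section \<open>Freezing the remaining coordinates\<close>

abbreviation PL :: "nat set \<Rightarrow> (nat \<Rightarrow> real) measure"
  where "PL I \<equiv> (\<Pi>\<^sub>M i\<in>I. (lborel :: real measure))"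

interpretation PL: product_sigma_finite "\<lambda>_::nat. lborel :: real measure"
  by standard

lemma measurable_PL_upd [measurable]:
  assumes "i \<in> J" and [measurable]: "f \<in> M \<rightarrow>\<^sub>M PL (J - {i})" "g \<in> borel_measurable M"
  shows "(\<lambda>x. (f x)(i := g x)) \<in> M \<rightarrow>\<^sub>M PL J"
proof -
  have "(\<lambda>x. (f x)(i := g x)) \<in> M \<rightarrow>\<^sub>M PL (insert i (J - {i}))"
    by measurable
  then show ?thesis using assms(1) by (simp add: insert_absorb)
qed

lemma nn_integral_PL_insert:
  assumes "finite I" "i \<notin> I" "f \<in> borel_measurable (PL (insert i I))"
  shows "(\<integral>\<^sup>+x. f x \<partial>PL (insert i I)) = (\<integral>\<^sup>+s. \<integral>\<^sup>+x. f (x(i := s)) \<partial>PL I \<partial>lborel)"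
  using PL.product_nn_integral_insert_rev[OF assms] .

lemma nn_integral_PL_pair_insert:
  assumes I: "finite I" "i \<notin> I" and [measurable]: "f \<in> borel_measurable (PL (insert i I) \<Otimes>\<^sub>M lborel)"
  shows "(\<integral>\<^sup>+p. f p \<partial>(PL (insert i I) \<Otimes>\<^sub>M lborel))
    = (\<integral>\<^sup>+s. \<integral>\<^sup>+p. f ((fst p)(i := s), snd p) \<partial>(PL I \<Otimes>\<^sub>M lborel) \<partial>lborel)"
proof -
  have "(\<integral>\<^sup>+p. f p \<partial>(PL (insert i I) \<Otimes>\<^sub>M lborel))
      = (\<integral>\<^sup>+x. \<integral>\<^sup>+t. f (x, t) \<partial>lborel \<partial>PL (insert i I))"
    by (rule lborel.nn_integral_fst[symmetric]) measurable
  also have "\<dots> = (\<integral>\<^sup>+s. \<integral>\<^sup>+x. \<integral>\<^sup>+t. f (x(i := s), t) \<partial>lborel \<partial>PL I \<partial>lborel)"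
    using I by (intro nn_integral_PL_insert) measurable
  also have "\<dots> = (\<integral>\<^sup>+s. \<integral>\<^sup>+p. f ((fst p)(i := s), snd p) \<partial>(PL I \<Otimes>\<^sub>M lborel) \<partial>lborel)"
    by (intro nn_integral_cong, subst lborel.nn_integral_fst[symmetric]) (use I in simp_all)
  finally show ?thesis .
qed

lemma nn_integral_PL_singleton:
  assumes "f \<in> borel_measurable (PL {i})"
  shows "(\<integral>\<^sup>+x. f x \<partial>PL {i}) = (\<integral>\<^sup>+s. f ((\<lambda>_. undefined)(i := s)) \<partial>lborel)"
  using nn_integral_PL_insert[of "{}" i f] assms by (simp add: PL.nn_integral_empty)


text \<open>Each \<open>\<phi> j\<close> stands for a function raised to the power
  \<open>1 / a j\<close>, so that norms are powers of integrals. The families \<open>h\<close> and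
  \<open>\<phi>\<close> vary in the induction, because the hypothesis is applied to every slice of
  the released coordinate; for empty \<open>E\<close> the weights are the 2/3 of
  \<open>plane_estimate\<close>.\<close>

lemma frozen_coordinates_estimate:
  fixes h :: "nat \<Rightarrow> (nat \<Rightarrow> real) \<Rightarrow> real" and \<phi> :: "nat \<Rightarrow> (nat \<Rightarrow> real) \<times> real \<Rightarrow> ennreal"
  assumes fin: "finite E" and kl: "k \<noteq> l" "k \<notin> E" "l \<notin> E" and C: "1 \<le> C"
    and h: "\<And>j. j \<in> insert k (insert l E) \<Longrightarrow> h j \<in> borel_measurable (PL (insert k (insert l E)))"
    and base: "\<And>w. w \<in> coord_space E \<Longrightarrow>
      plane_estimate C (\<lambda>(u, s). h k (w(k := u, l := s))) (\<lambda>(u, s). h l (w(k := u, l := s)))"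
    and \<phi>: "\<And>j. j \<in> insert k (insert l E) \<Longrightarrow>
      \<phi> j \<in> borel_measurable (PL (insert k (insert l E) - {j}) \<Otimes>\<^sub>M lborel)"
  defines "J \<equiv> insert k (insert l E)"
  defines "a \<equiv> \<lambda>j. (if j = k \<or> j = l then 2 else 1) / real (card E + 3)"
  shows "(\<integral>\<^sup>+x. \<integral>\<^sup>+t. (\<Prod>j\<in>J. ennreal_powr (\<phi> j (restrict x (J - {j}), t + h j x)) (a j)) \<partial>lborel \<partial>PL J)
    \<le> C * (\<Prod>j\<in>J. ennreal_powr (\<integral>\<^sup>+p. \<phi> j p \<partial>(PL (J - {j}) \<Otimes>\<^sub>M lborel)) (a j))"
  using fin kl h base \<phi> unfolding J_def a_def
proof (induction E arbitrary: h \<phi> rule: finite_induct)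
  case empty
  \<comment> \<open>The only point of \<open>coord_space {}\<close>, as extensional functions are
    undefined off their index set; the assumption on frozen points is used at it.\<close>
  let ?o = "\<lambda>_::nat. undefined :: real"
  define F G where "F p = \<phi> k (?o(l := fst p), snd p)" and "G p = \<phi> l (?o(k := fst p), snd p)" for p
  have kl_diff: "{k, l} - {k} = {l}" "{k, l} - {l} = {k}" using empty.prems(1) by auto
  have [measurable]: "h k \<in> borel_measurable (PL {k, l})" "h l \<in> borel_measurable (PL {k, l})"
    "\<phi> k \<in> borel_measurable (PL {l} \<Otimes>\<^sub>M lborel)" "\<phi> l \<in> borel_measurable (PL {k} \<Otimes>\<^sub>M lborel)"
    using empty.prems(4)[of k] empty.prems(4)[of l] empty.prems(6)[of k] empty.prems(6)[of l]
    by (simp_all add: kl_diff)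
  have [measurable]: "?o \<in> space (PL {})" by simp
  have upd [measurable]: "(\<lambda>p. ?o(i := fst p)) \<in> lborel \<Otimes>\<^sub>M lborel \<rightarrow>\<^sub>M PL {i}" for i
    by measurable
  have FG [measurable]: "F \<in> borel_measurable (lborel \<Otimes>\<^sub>M lborel)" "G \<in> borel_measurable (lborel \<Otimes>\<^sub>M lborel)"
    unfolding F_def G_def by measurable
  have int: "(\<integral>\<^sup>+p. \<phi> j p \<partial>(PL {i} \<Otimes>\<^sub>M lborel)) = (\<integral>\<^sup>+p. \<phi> j (?o(i := fst p), snd p) \<partial>(lborel \<Otimes>\<^sub>M lborel))"
    if [measurable]: "\<phi> j \<in> borel_measurable (PL {i} \<Otimes>\<^sub>M lborel)" for i j
  proof -
    have "(\<integral>\<^sup>+p. \<phi> j p \<partial>(PL {i} \<Otimes>\<^sub>M lborel)) = (\<integral>\<^sup>+x. \<integral>\<^sup>+t. \<phi> j (x, t) \<partial>lborel \<partial>PL {i})"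
      by (rule lborel.nn_integral_fst[symmetric]) measurable
    also have "\<dots> = (\<integral>\<^sup>+s. \<integral>\<^sup>+t. \<phi> j (?o(i := s), t) \<partial>lborel \<partial>lborel)"
      by (rule nn_integral_PL_singleton) measurable
    also have "\<dots> = (\<integral>\<^sup>+p. \<phi> j (?o(i := fst p), snd p) \<partial>(lborel \<Otimes>\<^sub>M lborel))"
      by (subst lborel.nn_integral_fst[symmetric]) simp_all
    finally show ?thesis .
  qed
  have kl_prod: "(\<Prod>j\<in>{k, l}. f j) = f k * f l" for f :: "nat \<Rightarrow> ennreal"
    using empty.prems(1) by simp
  have restr: "restrict (?o(k := u, l := s)) {l} = ?o(l := s)" "restrict (?o(k := u)) {k} = ?o(k := u)" for u s
    using empty.prems(1) by (auto simp: restrict_def fun_eq_iff)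
  define Q where "Q x = (\<integral>\<^sup>+t. ennreal_powr (\<phi> k (restrict x {l}, t + h k x)) (2 / 3) *
      ennreal_powr (\<phi> l (restrict x {k}, t + h l x)) (2 / 3) \<partial>lborel)" for x
  have rm [measurable]: "(\<lambda>p. restrict (fst p) {l}) \<in> PL {k, l} \<Otimes>\<^sub>M lborel \<rightarrow>\<^sub>M PL {l}"
    "(\<lambda>p. restrict (fst p) {k}) \<in> PL {k, l} \<Otimes>\<^sub>M lborel \<rightarrow>\<^sub>M PL {k}"
    by (rule measurable_compose[OF measurable_fst measurable_restrict_subset], simp)+
  have [measurable]: "Q \<in> borel_measurable (PL {k, l})"
    unfolding Q_def by measurable
  have "(\<integral>\<^sup>+x. Q x \<partial>PL {k, l}) = (\<integral>\<^sup>+u. \<integral>\<^sup>+x. Q (x(k := u)) \<partial>PL {l} \<partial>lborel)"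
    using empty.prems(1) by (intro nn_integral_PL_insert) auto
  also have "\<dots> = (\<integral>\<^sup>+u. \<integral>\<^sup>+s. Q (?o(l := s, k := u)) \<partial>lborel \<partial>lborel)"
    by (intro nn_integral_cong, rule nn_integral_PL_singleton) measurable
  also have "\<dots> = (\<integral>\<^sup>+u. \<integral>\<^sup>+s. \<integral>\<^sup>+t. ennreal_powr (F (s, t + h k (?o(k := u, l := s)))) (2 / 3) *
          ennreal_powr (G (u, t + h l (?o(k := u, l := s)))) (2 / 3) \<partial>lborel \<partial>lborel \<partial>lborel)"
    using empty.prems(1) by (simp add: Q_def restr F_def G_def fun_upd_twist)
  also have "\<dots> \<le> C * (ennreal_powr (\<integral>\<^sup>+p. F p \<partial>(lborel \<Otimes>\<^sub>M lborel)) (2 / 3) *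
               ennreal_powr (\<integral>\<^sup>+p. G p \<partial>(lborel \<Otimes>\<^sub>M lborel)) (2 / 3))"
    using empty.prems(5)[of ?o] FG unfolding plane_estimate_def by fastforce
  finally show ?case
    unfolding kl_prod kl_diff by (simp add: int Q_def F_def G_def empty.prems(1))
next
  case (insert i E)
  define J where "J = insert k (insert l E)"
  \<comment> \<open>The denominator of the weights on \<open>J\<close>, one more than the number of
    coordinates in \<open>J\<close>. The old weights are \<open>b\<close>, the new ones
    \<open>a\<close>, with denominator \<open>m + 1\<close>, and \<open>\<theta>\<close> is their
    ratio.\<close>
  define m where "m = real (card E + 3)"
  define b where "b j = (if j = k \<or> j = l then 2 else 1) / m" for j
  define a where "a j = (if j = k \<or> j = l then 2 else 1) / (m + 1)" for j
  define \<theta> where "\<theta> = m / (m + 1)"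
  have m: "0 < m" by (simp add: m_def)
  have \<theta>: "0 < \<theta>" "\<theta> \<le> 1" "1 / (m + 1) + \<theta> = 1" using m by (auto simp: \<theta>_def field_simps)
  have a: "a j = b j * \<theta>" "0 < a j" for j
    using m by (auto simp: a_def b_def \<theta>_def)
  have m1: "m + 1 = real (card (insert i E) + 3)"
    using insert.hyps by (simp add: m_def)
  have ins: "insert k (insert l (insert i E)) = insert i J" by (auto simp: J_def)
  have i: "i \<notin> J" and fJ: "finite J" using insert by (auto simp: J_def)
  have ai: "a i = 1 / (m + 1)" using i by (auto simp: a_def J_def)
  \<comment> \<open>The condition for the final Hoelder inequality in \<open>s\<close>: the
    numerators are 2, 2 and \<open>card E\<close> times 1, the denominator is
    \<open>card E + 4\<close>.\<close>
  have sum_a: "sum a J = 1"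
  proof -
    have "sum a E = (\<Sum>j\<in>E. 1 / (m + 1))"
      using insert.prems by (intro sum.cong) (auto simp: a_def)
    then have "sum a E = real (card E) / (m + 1)" by simp
    moreover have "sum a J = a k + (a l + sum a E)"
      using insert by (simp add: J_def)
    moreover have "a k = 2 / (m + 1)" "a l = 2 / (m + 1)" by (simp_all add: a_def)
    ultimately have "sum a J = (real (card E) + 4) / (m + 1)"
      by (simp add: add_divide_distrib)
    also have "real (card E) + 4 = m + 1" by (simp add: m_def)
    finally show ?thesis using m by simp
  qed
  note h = insert.prems(4)[unfolded ins] and \<phi> = insert.prems(6)[unfolded ins]
  have Ji: "insert i J - {i} = J" using i by auto
  have Jj: "insert i J - {j} = insert i (J - {j})" if "j \<in> J" for j using i that by auto
  define hs where "hs s j x = h j (x(i := s))" for s j x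
  define \<phi>s where "\<phi>s s j p = \<phi> j ((fst p)(i := s), snd p)" for s j p
  have h_i [measurable]: "h i \<in> borel_measurable (PL (insert i J))"
    and \<phi>_i [measurable]: "\<phi> i \<in> borel_measurable (PL J \<Otimes>\<^sub>M lborel)"
    using h[of i] \<phi>[of i] by (simp_all add: Ji)
  have h_j [measurable]: "h j \<in> borel_measurable (PL (insert i J))"
    and \<phi>_j [measurable]: "\<phi> j \<in> borel_measurable (PL (insert i (J - {j})) \<Otimes>\<^sub>M lborel)" if "j \<in> J" for j
    using h[of j] \<phi>[of j] that by (simp_all add: Jj)
  have hs [measurable]: "hs s j \<in> borel_measurable (PL J)" if [simp]: "j \<in> J" for s j
    unfolding hs_def by measurable
  have \<phi>s [measurable]: "\<phi>s s j \<in> borel_measurable (PL (J - {j}) \<Otimes>\<^sub>M lborel)" if [simp]: "j \<in> J" for s j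
    unfolding \<phi>s_def by measurable
  define I where "I s j = (\<integral>\<^sup>+p. \<phi>s s j p \<partial>(PL (J - {j}) \<Otimes>\<^sub>M lborel))" for s j
  define Y where "Y j = (\<integral>\<^sup>+p. \<phi> j p \<partial>(PL (insert i J - {j}) \<Otimes>\<^sub>M lborel))" for j
  have Y: "Y j = (\<integral>\<^sup>+s. I s j \<partial>lborel)" if j: "j \<in> J" for j
    unfolding Y_def I_def \<phi>s_def Jj[OF j]
    using fJ i j by (intro nn_integral_PL_pair_insert) auto
  have I_meas: "(\<lambda>s. I s j) \<in> borel_measurable lborel" if [simp]: "j \<in> J" for j
  proof -
    interpret sigma_finite_measure "PL (J - {j}) \<Otimes>\<^sub>M lborel"
      using fJ by (intro sigma_finite_pair_measure PL.sigma_finite lborel.sigma_finite_measure_axioms) auto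
    show ?thesis
      unfolding I_def \<phi>s_def by (rule borel_measurable_nn_integral) measurable
  qed
  have IH: "(\<integral>\<^sup>+x. \<integral>\<^sup>+t. (\<Prod>j\<in>J. ennreal_powr (\<phi>s s j (restrict x (J - {j}), t + hs s j x)) (b j)) \<partial>lborel \<partial>PL J)
    \<le> C * (\<Prod>j\<in>J. ennreal_powr (I s j) (b j))" for s
    unfolding I_def b_def m_def J_def
  proof (rule insert.IH)
    \<comment> \<open>A frozen point on \<open>E\<close> together with the value \<open>s\<close> at
      \<open>i\<close> is a frozen point on \<open>insert i E\<close>, so the planar estimate holds
      on all slices with the same constant.\<close>
    show "plane_estimate C (\<lambda>(u, t). hs s k (w(k := u, l := t))) (\<lambda>(u, t). hs s l (w(k := u, l := t)))"
      if "w \<in> coord_space E" for w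
    proof -
      have "w(i := s) \<in> coord_space (insert i E)"
        using that by (auto simp: PiE_iff extensional_def)
      moreover have "w(k := u, l := t, i := s) = w(i := s, k := u, l := t)" for u t
        using insert.prems(2,3) by (auto simp: fun_eq_iff)
      ultimately show ?thesis
        unfolding hs_def by (simp only: insert.prems(5))
    qed
  qed (use insert.prems hs \<phi>s in \<open>auto simp: J_def\<close>)
  define P where "P s p = (\<Prod>j\<in>J. ennreal_powr (\<phi>s s j (restrict (fst p) (J - {j}), snd p + hs s j (fst p))) (b j))"
    for s p
  have rm [measurable]: "(\<lambda>p. restrict (fst p) (J' - {j})) \<in> PL J' \<Otimes>\<^sub>M lborel \<rightarrow>\<^sub>M PL (J' - {j})" for J' j
    by (rule measurable_compose[OF measurable_fst measurable_restrict_subset]) auto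
  have P [measurable]: "P s \<in> borel_measurable (PL J \<Otimes>\<^sub>M lborel)" for s
    unfolding P_def by measurable
  define Q where "Q x = (\<integral>\<^sup>+t. (\<Prod>j\<in>insert i J. ennreal_powr (\<phi> j (restrict x (insert i J - {j}), t + h j x)) (a j)) \<partial>lborel)" for x
  have "(\<lambda>p. ennreal_powr (\<phi> j (restrict (fst p) (insert i J - {j}), snd p + h j (fst p))) (a j))
      \<in> borel_measurable (PL (insert i J) \<Otimes>\<^sub>M lborel)" if j: "j \<in> insert i J" for j
  proof -
    note h[OF j, measurable]
    show ?thesis
      by (rule borel_measurable_ennreal_powr, rule measurable_compose[OF _ \<phi>[OF j]]) measurable
  qed
  then have Q [measurable]: "Q \<in> borel_measurable (PL (insert i J))"
    unfolding Q_def
    by (intro lborel.borel_measurable_nn_integral) (auto simp: split_beta intro: borel_measurable_prod_ennreal)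
  have slice: "(\<integral>\<^sup>+x. Q (x(i := s)) \<partial>PL J)
      \<le> C * ennreal_powr (Y i) (a i) * (\<Prod>j\<in>J. ennreal_powr (I s j) (a j))" for s
  proof -
    have hm [measurable]: "(\<lambda>x. h i (x(i := s))) \<in> borel_measurable (PL J)"
      by measurable
    have "(\<integral>\<^sup>+p. P s p \<partial>(PL J \<Otimes>\<^sub>M lborel)) = (\<integral>\<^sup>+x. \<integral>\<^sup>+t. P s (x, t) \<partial>lborel \<partial>PL J)"
      by (rule lborel.nn_integral_fst[symmetric]) measurable
    then have "ennreal_powr (\<integral>\<^sup>+p. P s p \<partial>(PL J \<Otimes>\<^sub>M lborel)) \<theta>
        \<le> ennreal_powr (C * (\<Prod>j\<in>J. ennreal_powr (I s j) (b j))) \<theta>"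
      using IH[of s] \<theta> by (intro ennreal_powr_mono) (simp_all add: P_def)
    also have "\<dots> = ennreal_powr C \<theta> * (\<Prod>j\<in>J. ennreal_powr (I s j) (a j))"
      by (simp add: ennreal_powr_mult ennreal_powr_prod ennreal_powr_powr a(1))
    also have "\<dots> \<le> C * (\<Prod>j\<in>J. ennreal_powr (I s j) (a j))"
    proof (intro mult_right_mono)
      \<comment> \<open>Here \<open>1 \<le> C\<close> keeps the constant from depending on the
        number of released coordinates.\<close>
      show "ennreal_powr C \<theta> \<le> C"
      proof (cases C)
        case (real r)
        then have "1 \<le> r" using C by simp
        then have "r powr \<theta> \<le> r powr 1" using \<theta> by (intro powr_mono) auto
        with real \<open>1 \<le> r\<close> show ?thesis by (simp add: ennreal_powr_ennreal)
      qed simp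
    qed simp
    finally have P_le: "ennreal_powr (\<integral>\<^sup>+p. P s p \<partial>(PL J \<Otimes>\<^sub>M lborel)) \<theta>
        \<le> C * (\<Prod>j\<in>J. ennreal_powr (I s j) (a j))" .
    have "Q (x(i := s)) = (\<integral>\<^sup>+t. ennreal_powr (\<phi> i (x, t + h i (x(i := s)))) (1 / (m + 1)) *
        ennreal_powr (P s (x, t)) \<theta> \<partial>lborel)" if x: "x \<in> space (PL J)" for x
    proof -
      have 1: "restrict (x(i := s)) J = x"
        using x i by (auto simp: space_PiM PiE_iff extensional_def fun_eq_iff restrict_def)
      have 2: "restrict (x(i := s)) (insert i J - {j}) = (restrict x (J - {j}))(i := s)" if "j \<in> J" for j
        using that i by (auto simp: fun_eq_iff restrict_def)
      have "(\<Prod>j\<in>J. ennreal_powr (\<phi> j (restrict (x(i := s)) (insert i J - {j}), t + h j (x(i := s)))) (a j))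
        = ennreal_powr (P s (x, t)) \<theta>" for t
        unfolding P_def ennreal_powr_prod
        by (intro prod.cong refl) (simp add: 2 \<phi>s_def hs_def ennreal_powr_powr a(1))
      then show ?thesis
        unfolding Q_def using i fJ by (simp add: Ji 1 ai)
    qed
    then have "(\<integral>\<^sup>+x. Q (x(i := s)) \<partial>PL J)
        = (\<integral>\<^sup>+x. \<integral>\<^sup>+t. ennreal_powr (\<phi> i (x, t + h i (x(i := s)))) (1 / (m + 1)) *
          ennreal_powr (P s (x, t)) \<theta> \<partial>lborel \<partial>PL J)"
      by (rule nn_integral_cong)
    also have "\<dots> = (\<integral>\<^sup>+p. ennreal_powr (\<phi> i (fst p, snd p + h i ((fst p)(i := s)))) (1 / (m + 1)) *
          ennreal_powr (P s p) \<theta> \<partial>(PL J \<Otimes>\<^sub>M lborel))"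
      by (subst lborel.nn_integral_fst[symmetric]) simp_all
    also have "\<dots> \<le> ennreal_powr (\<integral>\<^sup>+p. \<phi> i (fst p, snd p + h i ((fst p)(i := s))) \<partial>(PL J \<Otimes>\<^sub>M lborel)) (1 / (m + 1)) *
        ennreal_powr (\<integral>\<^sup>+p. P s p \<partial>(PL J \<Otimes>\<^sub>M lborel)) \<theta>"
      by (rule nn_integral_powr_mult_le) (use \<theta> m in auto)
    also have "(\<integral>\<^sup>+p. \<phi> i (fst p, snd p + h i ((fst p)(i := s))) \<partial>(PL J \<Otimes>\<^sub>M lborel)) = Y i"
      unfolding Y_def Ji by (rule nn_integral_pair_shift) measurable
    also have "ennreal_powr (Y i) (1 / (m + 1)) * ennreal_powr (\<integral>\<^sup>+p. P s p \<partial>(PL J \<Otimes>\<^sub>M lborel)) \<theta>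
        \<le> ennreal_powr (Y i) (1 / (m + 1)) * (C * (\<Prod>j\<in>J. ennreal_powr (I s j) (a j)))"
      by (intro mult_left_mono P_le) simp
    finally show ?thesis
      by (simp only: ai mult_ac)
  qed
  have "(\<integral>\<^sup>+x. Q x \<partial>PL (insert i J)) = (\<integral>\<^sup>+s. \<integral>\<^sup>+x. Q (x(i := s)) \<partial>PL J \<partial>lborel)"
    using fJ i by (intro nn_integral_PL_insert) auto
  also have "\<dots> \<le> (\<integral>\<^sup>+s. C * ennreal_powr (Y i) (a i) * (\<Prod>j\<in>J. ennreal_powr (I s j) (a j)) \<partial>lborel)"
    by (intro nn_integral_mono slice)
  also have "\<dots> = C * ennreal_powr (Y i) (a i) * (\<integral>\<^sup>+s. (\<Prod>j\<in>J. ennreal_powr (I s j) (a j)) \<partial>lborel)"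
    using I_meas by (intro nn_integral_cmult borel_measurable_prod_ennreal borel_measurable_ennreal_powr)
  also have "\<dots> \<le> C * ennreal_powr (Y i) (a i) * (\<Prod>j\<in>J. ennreal_powr (\<integral>\<^sup>+s. I s j \<partial>lborel) (a j))"
    by (intro mult_left_mono nn_integral_prod_powr_le fJ a sum_a I_meas) auto
  also have "\<dots> = C * (\<Prod>j\<in>insert i J. ennreal_powr (Y j) (a j))"
    using i fJ by (simp add: Y mult.assoc)
  finally show ?case
    unfolding ins Q_def Y_def a_def m1 .
qed

section \<open>Measurability and reindexing of coordinates\<close>

lemma floor_approx_tendsto:
  fixes s :: real
  shows "(\<lambda>n. of_int \<lfloor>real n * s\<rfloor> / real n) \<longlonglongrightarrow> s"
proof (rule tendsto_sandwich)
  show "eventually (\<lambda>n. s - 1 / real n \<le> of_int \<lfloor>real n * s\<rfloor> / real n) sequentially"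
  proof (rule eventually_sequentiallyI[of 1])
    fix n :: nat assume "1 \<le> n"
    moreover have "real n * s - 1 \<le> of_int \<lfloor>real n * s\<rfloor>" by linarith
    ultimately have "(real n * s - 1) / real n \<le> of_int \<lfloor>real n * s\<rfloor> / real n"
      by (intro divide_right_mono) auto
    with \<open>1 \<le> n\<close> show "s - 1 / real n \<le> of_int \<lfloor>real n * s\<rfloor> / real n"
      by (simp add: diff_divide_distrib)
  qed
  show "eventually (\<lambda>n. of_int \<lfloor>real n * s\<rfloor> / real n \<le> s) sequentially"
  proof (rule eventually_sequentiallyI[of 1])
    fix n :: nat assume "1 \<le> n"
    moreover have "of_int \<lfloor>real n * s\<rfloor> \<le> real n * s" by linarith
    ultimately show "of_int \<lfloor>real n * s\<rfloor> / real n \<le> s"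
      by (simp add: field_simps)
  qed
  show "(\<lambda>n. s - 1 / real n) \<longlonglongrightarrow> s"
    using tendsto_diff[OF tendsto_const lim_const_over_n[of 1]] by simp
qed simp

text \<open>Discretising one coordinate at a time exhibits the function as a limit of functions
  that are measurable in one coordinate fewer.\<close>
lemma separately_continuous_measurable:
  fixes g :: "(nat \<Rightarrow> real) \<Rightarrow> real"
  assumes "finite I"
    and cont: "\<And>x i. x \<in> coord_space I \<Longrightarrow> i \<in> I \<Longrightarrow> isCont (\<lambda>s. g (x(i := s))) (x i)"
  shows "g \<in> borel_measurable (PL I)"
proof -
  \<comment> \<open>Coordinates in \<open>J\<close> vary and the others are frozen at
    \<open>z\<close>; the induction over \<open>J\<close> leaves \<open>z\<close> arbitrary, so that
    the next coordinate can be frozen at grid values.\<close>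
  define mix where "mix J y z = (\<lambda>i. if i \<in> J then y i else z i)" for J and y z :: "nat \<Rightarrow> real"
  have "(\<lambda>y. g (mix J y z)) \<in> borel_measurable (PL J)" if "J \<subseteq> I" "z \<in> coord_space I" for J z
    using finite_subset[OF that(1) assms(1)] that
  proof (induction J arbitrary: z rule: finite_induct)
    case empty
    then show ?case by (simp add: mix_def)
  next
    case (insert i J)
    define f where "f n q y = g (mix J y (z(i := of_int q / real n)))" for n :: nat and q :: int and y
    have f: "f n q \<in> borel_measurable (PL (insert i J))" for n q
    proof -
      have "z(i := of_int q / real n) \<in> coord_space I"
        using insert.prems by (auto simp: PiE_iff extensional_def)
      then have "(\<lambda>y. g (mix J y (z(i := of_int q / real n)))) \<in> borel_measurable (PL J)"
        using insert by auto
      from measurable_compose[OF measurable_restrict_subset[of J "insert i J"] this]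
      have "(\<lambda>y. g (mix J (restrict y J) (z(i := of_int q / real n)))) \<in> borel_measurable (PL (insert i J))"
        by auto
      moreover have "mix J (restrict y J) w = mix J y w" for y w
        by (auto simp: mix_def fun_eq_iff)
      ultimately show ?thesis by (simp add: f_def[abs_def])
    qed
    have fl: "(\<lambda>y. \<lfloor>real n * y i\<rfloor>) \<in> PL (insert i J) \<rightarrow>\<^sub>M count_space UNIV" for n
      by measurable
    \<comment> \<open>For each \<open>n\<close> there are only countably many grid values, so
      selecting one by the coordinate \<open>y i\<close> itself stays measurable.\<close>
    have "(\<lambda>y. f n \<lfloor>real n * y i\<rfloor> y) \<in> borel_measurable (PL (insert i J))" for n
      by (rule measurable_compose_countable[OF f fl])
    then show ?case
    proof (rule borel_measurable_LIMSEQ_real[rotated])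
      fix y assume "y \<in> space (PL (insert i J))"
      define x where "x = mix (insert i J) y z"
      have "x \<in> coord_space I"
        using insert.prems by (auto simp: x_def mix_def PiE_iff extensional_def)
      then have "isCont (\<lambda>s. g (x(i := s))) (x i)"
        using insert.prems cont by auto
      moreover have "(\<lambda>n. of_int \<lfloor>real n * y i\<rfloor> / real n) \<longlonglongrightarrow> x i"
        using floor_approx_tendsto[of "y i"] by (simp add: x_def mix_def)
      ultimately have "(\<lambda>n. g (x(i := of_int \<lfloor>real n * y i\<rfloor> / real n))) \<longlonglongrightarrow> g (x(i := x i))"
        by (rule isCont_tendsto_compose)
      moreover have "x(i := s) = mix J y (z(i := s))" for s
        using insert.hyps by (auto simp: x_def mix_def fun_eq_iff)
      ultimately show "(\<lambda>n. f n \<lfloor>real n * y i\<rfloor> y) \<longlonglongrightarrow> g (mix (insert i J) y z)"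
        by (simp add: f_def flip: x_def)
    qed
  qed
  from this[of I "\<lambda>i\<in>I. 0"]
  have "(\<lambda>y. g (mix I y (\<lambda>i\<in>I. 0))) \<in> borel_measurable (PL I)" by auto
  moreover have "mix I y (\<lambda>i\<in>I. 0) = y" if "y \<in> space (PL I)" for y
    using that by (auto simp: mix_def space_PiM PiE_iff extensional_def fun_eq_iff)
  ultimately show ?thesis
    by (subst measurable_cong[of _ _ "\<lambda>y. g (mix I y (\<lambda>i\<in>I. 0))"]) auto
qed

text \<open>Partial derivatives give continuity along every coordinate line.\<close>

lemma C1_on_space_measurable:
  assumes "C1_on_space m g"
  shows "g \<in> borel_measurable (PL {1..m})"
proof (rule separately_continuous_measurable)
  show "isCont (\<lambda>s. g (x(i := s))) (x i)" if "x \<in> coord_space {1..m}" "i \<in> {1..m}" for x i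
    using assms that unfolding C1_on_space_def by (blast intro: DERIV_isCont)
qed simp

text \<open>A Borel version is raised to \<open>top\<close> on a null set that contains all points
  of disagreement. Pointwise domination survives composition with any map, whereas almost everywhere
  equality would require control of preimages of null sets under \<open>rho\<close>.\<close>

lemma completion_borel_majorant:
  fixes f :: "'a \<Rightarrow> ennreal"
  assumes "f \<in> borel_measurable (completion M)"
  shows "\<exists>g\<in>borel_measurable M. (\<forall>x\<in>space M. f x \<le> g x) \<and> (AE x in M. f x = g x)"
proof -
  obtain g where g [measurable]: "g \<in> borel_measurable M" and ae: "AE x in M. f x = g x"
    using completion_ex_borel_measurable[OF assms] by blast
  obtain N where N: "N \<in> null_sets M" "{x \<in> space M. f x \<noteq> g x} \<subseteq> N"
    using ae by (auto elim!: AE_E)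
  have [measurable]: "N \<in> sets M" using N by auto
  have "AE x in M. x \<notin> N" by (rule AE_not_in[OF N(1)])
  then have "AE x in M. f x = (if x \<in> N then top else g x)"
    using ae by eventually_elim auto
  moreover have "\<forall>x\<in>space M. f x \<le> (if x \<in> N then top else g x)"
    using N by auto
  moreover have "(\<lambda>x. if x \<in> N then top else g x) \<in> borel_measurable M"
    by measurable
  ultimately show ?thesis
    by (intro bexI[of _ "\<lambda>x. if x \<in> N then top else g x"] conjI)
qed

text \<open>Product measures are determined by boxes, and the preimage of a box under a relabelling
  of coordinates is the box with relabelled sides.\<close>

lemma distr_PL_reindex:
  assumes I: "finite I" "inj_on e I"
  shows "distr (PL (e ` I)) (PL I) (\<lambda>y. \<lambda>i\<in>I. y (e i)) = PL I"
proof (rule PL.PiM_eqI)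
  fix A :: "nat \<Rightarrow> real set" assume A: "\<And>i. i \<in> I \<Longrightarrow> A i \<in> sets lborel"
  have m: "(\<lambda>y. \<lambda>i\<in>I. y (e i)) \<in> PL (e ` I) \<rightarrow>\<^sub>M PL I"
    by measurable
  have "(\<lambda>y. \<lambda>i\<in>I. y (e i)) -` Pi\<^sub>E I A \<inter> space (PL (e ` I)) = Pi\<^sub>E (e ` I) (A \<circ> the_inv_into I e)"
    using I(2) by (auto simp: space_PiM PiE_iff the_inv_into_f_f)
  then have "emeasure (distr (PL (e ` I)) (PL I) (\<lambda>y. \<lambda>i\<in>I. y (e i))) (Pi\<^sub>E I A)
      = emeasure (PL (e ` I)) (Pi\<^sub>E (e ` I) (A \<circ> the_inv_into I e))"
    using m I A by (subst emeasure_distr) (auto intro: sets_PiM_I_finite)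
  also have "\<dots> = (\<Prod>i\<in>I. emeasure lborel (A i))"
    using I A by (subst PL.emeasure_PiM) (auto simp: prod.reindex the_inv_into_f_f)
  finally show "emeasure (distr (PL (e ` I)) (PL I) (\<lambda>y. \<lambda>i\<in>I. y (e i))) (Pi\<^sub>E I A)
      = (\<Prod>i\<in>I. emeasure lborel (A i))" .
qed (use I in auto)

text \<open>The induction over coordinates keeps the original labels, in
  \<open>{1..m} - {j}\<close>, while the values of \<open>rho\<close> are renumbered to
  \<open>{1..m}\<close>. This map passes from the first convention to the second.\<close>

definition insert_last :: "nat \<Rightarrow> nat \<Rightarrow> (nat \<Rightarrow> real) \<times> real \<Rightarrow> nat \<Rightarrow> real"
  where "insert_last m j p = (delete_coord m j (fst p))(m := snd p)"

lemma skip_image: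
  assumes "j \<in> {1..m}"
  shows "(\<lambda>i. if i < j then i else Suc i) ` {1..m - 1} = {1..m} - {j}"
proof (intro equalityI subsetI)
  fix x assume x: "x \<in> {1..m} - {j}"
  show "x \<in> (\<lambda>i. if i < j then i else Suc i) ` {1..m - 1}"
  proof (cases "x < j")
    case True
    with x assms show ?thesis by (intro image_eqI[of _ _ x]) auto
  next
    case False
    with x assms show ?thesis by (intro image_eqI[of _ _ "x - 1"]) auto
  qed
next
  fix x assume "x \<in> (\<lambda>i. if i < j then i else Suc i) ` {1..m - 1}"
  then obtain i where "i \<in> {1..m - 1}" "x = (if i < j then i else Suc i)" by blast
  with assms show "x \<in> {1..m} - {j}" by (cases "i < j") auto
qed

lemma delete_coord_eq: "delete_coord m j x = (\<lambda>i\<in>{1..m - 1}. x (if i < j then i else Suc i))"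
  by (auto simp: delete_coord_def fun_eq_iff)

lemma delete_coord_measurable:
  assumes "j \<in> {1..m}"
  shows "delete_coord m j \<in> PL ({1..m} - {j}) \<rightarrow>\<^sub>M PL {1..m - 1}"
proof -
  have "(if i < j then i else Suc i) \<in> {1..m} - {j}" if "i \<in> {1..m - 1}" for i
    using that assms by auto
  then show ?thesis
    unfolding delete_coord_eq[abs_def] by (intro measurable_restrict measurable_component_singleton)
qed

lemma insert_last_measurable:
  assumes j: "j \<in> {1..m}"
  shows "insert_last m j \<in> PL ({1..m} - {j}) \<Otimes>\<^sub>M lborel \<rightarrow>\<^sub>M PL {1..m}"
proof -
  have "{1..m} - {m} = {1..m - 1}" using j by auto
  then show ?thesis
    unfolding insert_last_def using j measurable_compose[OF measurable_fst delete_coord_measurable[OF j]]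
    by (intro measurable_PL_upd) simp_all
qed

text \<open>Renumbering preserves the product measure on \<open>m - 1\<close> coordinates, and
  Fubini attaches the last one.\<close>

lemma nn_integral_insert_last:
  assumes j: "j \<in> {1..m}" and f [measurable]: "f \<in> borel_measurable (PL {1..m})"
  shows "(\<integral>\<^sup>+p. f (insert_last m j p) \<partial>(PL ({1..m} - {j}) \<Otimes>\<^sub>M lborel)) = (\<integral>\<^sup>+x. f x \<partial>PL {1..m})"
proof -
  note insert_last_measurable[OF j, measurable] delete_coord_measurable[OF j, measurable]
  define e where "e i = (if i < j then i else Suc i)" for i
  have e: "inj_on e {1..m - 1}" "e ` {1..m - 1} = {1..m} - {j}"
    using skip_image[OF j] by (auto simp: e_def inj_on_def split: if_splits)
  have ins: "{1..m} = insert m {1..m - 1}" using j by auto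
  have D: "distr (PL ({1..m} - {j})) (PL {1..m - 1}) (delete_coord m j) = PL {1..m - 1}"
    using distr_PL_reindex[OF _ e(1)] unfolding e(2) delete_coord_eq[abs_def] e_def by simp
  have [measurable]: "(\<lambda>y. y(m := t)) \<in> PL {1..m - 1} \<rightarrow>\<^sub>M PL {1..m}" for t
    unfolding ins by measurable
  interpret A: sigma_finite_measure "PL ({1..m} - {j})" by (rule PL.sigma_finite) simp
  interpret pair_sigma_finite "PL ({1..m} - {j})" "lborel :: real measure" ..
  have "(\<integral>\<^sup>+p. f (insert_last m j p) \<partial>(PL ({1..m} - {j}) \<Otimes>\<^sub>M lborel))
      = (\<integral>\<^sup>+t. \<integral>\<^sup>+y. f (insert_last m j (y, t)) \<partial>PL ({1..m} - {j}) \<partial>lborel)"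
    by (rule nn_integral_snd[symmetric]) measurable
  also have "\<dots> = (\<integral>\<^sup>+t. \<integral>\<^sup>+y. f (y(m := t)) \<partial>PL {1..m - 1} \<partial>lborel)"
  proof (rule nn_integral_cong)
    fix t :: real
    have "(\<lambda>y. f (y(m := t))) \<in> borel_measurable (distr (PL ({1..m} - {j})) (PL {1..m - 1}) (delete_coord m j))"
      unfolding D by measurable
    from nn_integral_distr[OF delete_coord_measurable[OF j] this]
    show "(\<integral>\<^sup>+y. f (insert_last m j (y, t)) \<partial>PL ({1..m} - {j})) = (\<integral>\<^sup>+y. f (y(m := t)) \<partial>PL {1..m - 1})"
      unfolding D insert_last_def fst_conv snd_conv by (rule sym)
  qed
  also have "\<dots> = (\<integral>\<^sup>+x. f x \<partial>PL {1..m})"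
    using f j unfolding ins by (intro nn_integral_PL_insert[symmetric]) auto
  finally show ?thesis .
qed

section \<open>The averaged estimate\<close>

lemma rho_eq_insert_last:
  assumes "j \<in> {1..2 * n}" "x \<in> space (PL {1..2 * n})"
  shows "rho n h j (x(2 * n + 1 := t)) = insert_last (2 * n) j (restrict x ({1..2 * n} - {j}), t + h j x)"
proof -
  have "restrict (x(2 * n + 1 := t)) {1..2 * n} = x"
    using assms(2) by (auto simp: space_PiM PiE_iff extensional_def fun_eq_iff restrict_def)
  moreover have "delete_coord (2 * n) j (restrict x ({1..2 * n} - {j})) = delete_coord (2 * n) j x"
    unfolding delete_coord_eq
  proof (rule restrict_ext)
    fix i assume i: "i \<in> {1..2 * n - 1}"
    have "(if i < j then i else Suc i) \<in> {1..2 * n} - {j}"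
      unfolding skip_image[OF assms(1), symmetric] using i by (rule imageI)
    then show "restrict x ({1..2 * n} - {j}) (if i < j then i else Suc i) = x (if i < j then i else Suc i)"
      by (rule restrict_apply')
  qed
  ultimately show ?thesis
    by (simp add: rho_def insert_last_def Let_def)
qed

text \<open>The Borel majorants dominate only on the space, so the values of \<open>rho\<close> have
  to be extensional; \<open>0 < n\<close> puts the updated index \<open>2 * n\<close> inside
  \<open>{1..2 * n}\<close>.\<close>

lemma rho_space:
  assumes "0 < n"
  shows "rho n h j p \<in> space (PL {1..2 * n})"
  unfolding space_PiM
proof (rule PiE_I)
  fix i assume "i \<notin> {1..2 * n}"
  then have "i \<noteq> 2 * n" "i \<notin> {1..2 * n - 1}" using assms by auto
  then show "rho n h j p i = undefined"
    by (auto simp: rho_def delete_coord_def Let_def)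
qed simp

text \<open>Enlarging the constant to \<open>max 1 C\<close> supplies the lower bound 1 on which
  \<open>plane_estimateI\<close> and the release of coordinates rely.\<close>

lemma L32_L3_property_plane_estimate:
  assumes L3: "L32_L3_property n h C" and h: "\<And>j. j \<in> {1..2 * n} \<Longrightarrow> h j \<in> borel_measurable (PL {1..2 * n})"
    and k: "k \<in> {1..n}" and z: "z \<in> coord_space ({1..2 * n} - {k, n + k})" and "C \<noteq> top"
  shows "plane_estimate (max 1 C) (\<lambda>(u, s). h k (z(k := u, n + k := s))) (\<lambda>(u, s). h (n + k) (z(k := u, n + k := s)))"
proof (rule plane_estimateI)
  have kl: "k \<in> {1..2 * n}" "n + k \<in> {1..2 * n}" "k \<in> {1..2 * n} - {n + k}" using k by auto
  have "{1..2 * n} - {n + k} - {k} = {1..2 * n} - {k, n + k}" by auto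
  then have "(\<lambda>p. z) \<in> lborel \<Otimes>\<^sub>M lborel \<rightarrow>\<^sub>M PL ({1..2 * n} - {n + k} - {k})"
    using z by (auto simp: space_PiM)
  then have upd: "(\<lambda>p. z(k := fst p, n + k := snd p)) \<in> lborel \<Otimes>\<^sub>M lborel \<rightarrow>\<^sub>M PL {1..2 * n}"
    using kl by (intro measurable_PL_upd) simp_all
  show "(\<lambda>(u, s). h k (z(k := u, n + k := s))) \<in> borel_measurable (lborel \<Otimes>\<^sub>M lborel)"
    "(\<lambda>(u, s). h (n + k) (z(k := u, n + k := s))) \<in> borel_measurable (lborel \<Otimes>\<^sub>M lborel)"
    using measurable_compose[OF upd h[OF kl(1)]] measurable_compose[OF upd h[OF kl(2)]]
    by (simp_all add: case_prod_beta')
next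
  fix f assume f: "f \<in> test_functions"
  have "Lp_norm lebesgue 3 (\<lambda>p. ennreal \<bar>T_op n h k z f p\<bar>) \<le> C * Lp_norm lebesgue (3 / 2) (\<lambda>p. ennreal \<bar>f p\<bar>)"
    using L3 k z f unfolding L32_L3_property_def by blast
  also have "\<dots> \<le> max 1 C * Lp_norm lebesgue (3 / 2) (\<lambda>p. ennreal \<bar>f p\<bar>)"
    by (intro mult_right_mono) auto
  finally show "Lp_norm lebesgue 3 (\<lambda>(u, t). ennreal \<bar>LINT s|lebesgue.
      f (s, t + (case (u, s) of (u, s) \<Rightarrow> h k (z(k := u, n + k := s))) -
        (case (u, s) of (u, s) \<Rightarrow> h (n + k) (z(k := u, n + k := s))))\<bar>)
      \<le> max 1 C * Lp_norm lebesgue (3 / 2) (\<lambda>p. ennreal \<bar>f p\<bar>)"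
    by (simp add: T_op_def Let_def case_prod_beta')
qed (use assms in \<open>auto simp: max_def\<close>)

text \<open>The pairs (k, n + k) partition the indices, so the weight 2 occurs once and the weight 1
  for the other n - 1 pairs.\<close>

lemma sum_pair_weights:
  assumes "j \<in> {1..2 * n}"
  shows "(\<Sum>k\<in>{1..n}. if j = k \<or> j = n + k then 2 else 1 :: real) = real n + 1"
proof -
  define k where "k = (if j \<le> n then j else j - n)"
  have k: "k \<in> {1..n}" using assms by (auto simp: k_def)
  have eq: "j = i \<or> j = n + i \<longleftrightarrow> i = k" if "i \<in> {1..n}" for i
    using that assms by (auto simp: k_def)
  have "(\<Sum>i\<in>{1..n}. if j = i \<or> j = n + i then 2 else 1 :: real) = (\<Sum>i\<in>{1..n}. 1 + (if i = k then 1 else 0))"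
    using eq by (intro sum.cong) auto
  also have "\<dots> = real n + 1"
    using k by (simp add: sum.distrib)
  finally show ?thesis .
qed

text \<open>Averaging the estimates for the pairs \<open>(k, n + k)\<close> by Hoelder's inequality replaces
  multilinear interpolation, since the form is an integral of a product.\<close>
lemma averaged_estimate:
  fixes h :: "nat \<Rightarrow> (nat \<Rightarrow> real) \<Rightarrow> real" and \<phi> :: "nat \<Rightarrow> (nat \<Rightarrow> real) \<times> real \<Rightarrow> ennreal"
  assumes n: "0 < n" and C: "1 \<le> C"
    and h: "\<And>j. j \<in> {1..2 * n} \<Longrightarrow> h j \<in> borel_measurable (PL {1..2 * n})"
    and base: "\<And>k z. k \<in> {1..n} \<Longrightarrow> z \<in> coord_space ({1..2 * n} - {k, n + k}) \<Longrightarrow>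
      plane_estimate C (\<lambda>(u, s). h k (z(k := u, n + k := s))) (\<lambda>(u, s). h (n + k) (z(k := u, n + k := s)))"
    and \<phi>: "\<And>j. j \<in> {1..2 * n} \<Longrightarrow> \<phi> j \<in> borel_measurable (PL ({1..2 * n} - {j}) \<Otimes>\<^sub>M lborel)"
  defines "J \<equiv> {1..2 * n}"
  defines "r \<equiv> real (n + 1) / real (n * (2 * n + 1))"
  shows "(\<integral>\<^sup>+x. \<integral>\<^sup>+t. (\<Prod>j\<in>J. ennreal_powr (\<phi> j (restrict x (J - {j}), t + h j x)) r) \<partial>lborel \<partial>PL J)
    \<le> C * (\<Prod>j\<in>J. ennreal_powr (\<integral>\<^sup>+p. \<phi> j p \<partial>(PL (J - {j}) \<Otimes>\<^sub>M lborel)) r)"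
proof -
  define a where "a k j = (if j = k \<or> j = n + k then 2 else 1) / real (2 * n + 1)" for k j
  define c where "c = 1 / real n"
  define g where "g j p = \<phi> j (restrict (fst p) (J - {j}), snd p + h j (fst p))" for j p
  define Y where "Y j = (\<integral>\<^sup>+p. \<phi> j p \<partial>(PL (J - {j}) \<Otimes>\<^sub>M lborel))" for j
  have c: "0 < c" "(\<Sum>k\<in>{1..n}. c) = 1" using n by (auto simp: c_def)
  have fin: "finite {1..n}" "{1..n} \<noteq> {}" using n by auto
  have g [measurable]: "g j \<in> borel_measurable (PL J \<Otimes>\<^sub>M lborel)" if j: "j \<in> J" for j
  proof -
    note h[OF j[unfolded J_def], folded J_def, measurable]
    have [measurable]: "(\<lambda>p. restrict (fst p) (J - {j})) \<in> PL J \<Otimes>\<^sub>M lborel \<rightarrow>\<^sub>M PL (J - {j})"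
      by (rule measurable_compose[OF measurable_fst measurable_restrict_subset]) auto
    show ?thesis
      unfolding g_def by (rule measurable_compose[OF _ \<phi>[OF j[unfolded J_def], folded J_def]]) measurable
  qed
  \<comment> \<open>With \<open>c = 1 / n\<close> the mean over \<open>k\<close> of the weights
    \<open>a k j\<close> is the reciprocal of the symmetric exponent, the same for all
    \<open>j\<close>.\<close>
  have r: "ennreal_powr y r = (\<Prod>k\<in>{1..n}. ennreal_powr (ennreal_powr y (a k j)) c)" if "j \<in> J" for y j
  proof -
    have "(\<Sum>k\<in>{1..n}. a k j * c) = (\<Sum>k\<in>{1..n}. if j = k \<or> j = n + k then 2 else 1) / real (2 * n + 1) * c"
      by (simp add: a_def sum_distrib_right sum_divide_distrib)
    also have "\<dots> = r"
      unfolding sum_pair_weights[OF that[unfolded J_def]] by (simp add: r_def c_def algebra_simps)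
    finally show ?thesis
      using ennreal_powr_sum[OF fin, of y "\<lambda>k. a k j * c"] by (simp add: ennreal_powr_powr)
  qed
  have swap: "(\<Prod>j\<in>J. ennreal_powr (y j) r)
      = (\<Prod>k\<in>{1..n}. ennreal_powr (\<Prod>j\<in>J. ennreal_powr (y j) (a k j)) c)" for y
    unfolding ennreal_powr_prod by (subst prod.swap) (intro prod.cong refl r)
  have pair: "(\<integral>\<^sup>+p. (\<Prod>j\<in>J. ennreal_powr (g j p) (a k j)) \<partial>(PL J \<Otimes>\<^sub>M lborel))
      \<le> C * (\<Prod>j\<in>J. ennreal_powr (Y j) (a k j))" if k: "k \<in> {1..n}" for k
  proof -
    define E where "E = {1..2 * n} - {k, n + k}"
    have J: "J = insert k (insert (n + k) E)" using k by (auto simp: J_def E_def)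
    note h' = h[folded J_def, unfolded J] and \<phi>' = \<phi>[folded J_def, unfolded J]
    have E: "finite E" "k \<notin> E" "n + k \<notin> E" "k \<noteq> n + k" using k by (auto simp: E_def)
    have "card J = 2 * n" by (simp add: J_def)
    moreover have "card J = card E + 2" unfolding J using E by simp
    ultimately have a: "a k j = (if j = k \<or> j = n + k then 2 else 1) / real (card E + 3)" for j
      by (simp add: a_def)
    have "(\<integral>\<^sup>+p. (\<Prod>j\<in>J. ennreal_powr (g j p) (a k j)) \<partial>(PL J \<Otimes>\<^sub>M lborel))
        = (\<integral>\<^sup>+x. \<integral>\<^sup>+t. (\<Prod>j\<in>J. ennreal_powr (g j (x, t)) (a k j)) \<partial>lborel \<partial>PL J)"
      by (rule lborel.nn_integral_fst[symmetric]) measurable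
    also have "\<dots> \<le> C * (\<Prod>j\<in>J. ennreal_powr (Y j) (a k j))"
      unfolding g_def Y_def a fst_conv snd_conv J
    proof (rule frozen_coordinates_estimate[OF E(1) E(4) E(2) E(3) C h' _ \<phi>'])
      show "plane_estimate C (\<lambda>(u, s). h k (w(k := u, n + k := s))) (\<lambda>(u, s). h (n + k) (w(k := u, n + k := s)))"
        if "w \<in> coord_space E" for w
        using base[OF k] that by (simp add: E_def)
    qed
    finally show ?thesis .
  qed
  have "(\<integral>\<^sup>+x. \<integral>\<^sup>+t. (\<Prod>j\<in>J. ennreal_powr (\<phi> j (restrict x (J - {j}), t + h j x)) r) \<partial>lborel \<partial>PL J)
      = (\<integral>\<^sup>+x. \<integral>\<^sup>+t. (\<Prod>j\<in>J. ennreal_powr (g j (x, t)) r) \<partial>lborel \<partial>PL J)"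
    by (simp only: g_def fst_conv snd_conv)
  also have "\<dots> = (\<integral>\<^sup>+p. (\<Prod>j\<in>J. ennreal_powr (g j p) r) \<partial>(PL J \<Otimes>\<^sub>M lborel))"
    by (rule lborel.nn_integral_fst) measurable
  also have "\<dots> = (\<integral>\<^sup>+p. (\<Prod>k\<in>{1..n}. ennreal_powr (\<Prod>j\<in>J. ennreal_powr (g j p) (a k j)) c) \<partial>(PL J \<Otimes>\<^sub>M lborel))"
    by (simp only: swap)
  also have "\<dots> \<le> (\<Prod>k\<in>{1..n}. ennreal_powr (\<integral>\<^sup>+p. (\<Prod>j\<in>J. ennreal_powr (g j p) (a k j)) \<partial>(PL J \<Otimes>\<^sub>M lborel)) c)"
    using c by (intro nn_integral_prod_powr_le) auto
  also have "\<dots> \<le> (\<Prod>k\<in>{1..n}. ennreal_powr (C * (\<Prod>j\<in>J. ennreal_powr (Y j) (a k j))) c)"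
    using c by (intro prod_mono_ennreal ennreal_powr_mono pair) auto
  also have "\<dots> = (\<Prod>k\<in>{1..n}. ennreal_powr C c) * (\<Prod>j\<in>J. ennreal_powr (Y j) r)"
    by (simp only: swap ennreal_powr_mult prod.distrib)
  \<comment> \<open>The \<open>n\<close> factors with exponent \<open>1 / n\<close> multiply back to
    \<open>C\<close>, so averaging costs nothing in the constant.\<close>
  also have "(\<Prod>k\<in>{1..n}. ennreal_powr C c) = C"
    using ennreal_powr_sum[OF fin, of C "\<lambda>_. c"] by (simp only: c ennreal_powr_1)
  finally show ?thesis unfolding Y_def .
qed

theorem theorem5p16:
  fixes n :: nat and C :: ennreal
  assumes "n > 1" and "C < \<infinity>"
  shows "\<exists>C' :: ennreal. 0 < C' \<and> C' < \<infinity> \<and>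
    (\<forall>h :: nat \<Rightarrow> (nat \<Rightarrow> real) \<Rightarrow> real.
       (\<forall>j\<in>{1..2 * n}. C1_on_space (2 * n) (h j)) \<longrightarrow>
       L32_L3_property n h C \<longrightarrow>
       (\<forall>f :: nat \<Rightarrow> (nat \<Rightarrow> real) \<Rightarrow> ennreal.
          (\<forall>j\<in>{1..2 * n}. f j \<in> borel_measurable (leb (2 * n))) \<longrightarrow>
          (\<integral>\<^sup>+ p. (\<Prod>j\<in>{1..2 * n}. f j (rho n h j p)) \<partial>leb (2 * n + 1))
            \<le> C' * (\<Prod>j\<in>{1..2 * n}.
                 Lp_norm (leb (2 * n)) (real (n * (2 * n + 1)) / real (n + 1)) (f j))))"
proof (intro exI[of _ "max 1 C"] conjI allI impI)
  show "0 < max 1 C" by (simp add: less_max_iff_disj)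
  show "max 1 C < \<infinity>" using assms(2) by simp
next
  fix h :: "nat \<Rightarrow> (nat \<Rightarrow> real) \<Rightarrow> real" and f :: "nat \<Rightarrow> (nat \<Rightarrow> real) \<Rightarrow> ennreal"
  assume C1: "\<forall>j\<in>{1..2 * n}. C1_on_space (2 * n) (h j)"
    and L3: "L32_L3_property n h C"
    and f: "\<forall>j\<in>{1..2 * n}. f j \<in> borel_measurable (leb (2 * n))"
  define J where "J = {1..2 * n}"
  define q where "q = real (n * (2 * n + 1)) / real (n + 1)"
  define r where "r = real (n + 1) / real (n * (2 * n + 1))"
  have "n * (2 * n + 1) \<noteq> 0" using assms(1) by simp
  then have "real (n * (2 * n + 1)) \<noteq> 0" by (simp only: of_nat_eq_0_iff not_False_eq_True)
  then have qr: "q * r = 1" "1 / q = r"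
    by (simp_all add: q_def r_def del: of_nat_mult)
  have h: "h j \<in> borel_measurable (PL J)" if "j \<in> J" for j
    using C1 that unfolding J_def by (blast intro: C1_on_space_measurable)
  have "\<forall>j\<in>J. \<exists>g. g \<in> borel_measurable (PL J) \<and> (\<forall>x\<in>space (PL J). f j x \<le> g x) \<and> (AE x in PL J. f j x = g x)"
  proof
    fix j assume "j \<in> J"
    then have "f j \<in> borel_measurable (completion (PL J))"
      using f unfolding leb_def J_def by blast
    from completion_borel_majorant[OF this]
    show "\<exists>g. g \<in> borel_measurable (PL J) \<and> (\<forall>x\<in>space (PL J). f j x \<le> g x) \<and> (AE x in PL J. f j x = g x)"
      unfolding Bex_def .
  qed
  from bchoice[OF this] obtain g where
    "\<forall>j\<in>J. g j \<in> borel_measurable (PL J) \<and> (\<forall>x\<in>space (PL J). f j x \<le> g j x) \<and> (AE x in PL J. f j x = g j x)" ..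
  then have g: "\<And>j. j \<in> J \<Longrightarrow> g j \<in> borel_measurable (PL J)"
    "\<And>j x. j \<in> J \<Longrightarrow> x \<in> space (PL J) \<Longrightarrow> f j x \<le> g j x"
    "\<And>j. j \<in> J \<Longrightarrow> AE x in PL J. f j x = g j x"
    by simp_all
  \<comment> \<open>After passing to \<open>q\<close>-th powers the norm is the \<open>r\<close>-th
    power of an integral, and the exponent \<open>r\<close> in the integrand undoes
    \<open>q\<close>.\<close>
  define \<phi> where "\<phi> j p = ennreal_powr (g j (insert_last (2 * n) j p)) q" for j p
  have \<phi>: "\<phi> j \<in> borel_measurable (PL (J - {j}) \<Otimes>\<^sub>M lborel)" if "j \<in> J" for j
    unfolding \<phi>_def[abs_def] J_def using that g(1)[OF that] unfolding J_def
    by (intro borel_measurable_ennreal_powr measurable_compose[OF insert_last_measurable])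
  have norm: "ennreal_powr (\<integral>\<^sup>+p. \<phi> j p \<partial>(PL (J - {j}) \<Otimes>\<^sub>M lborel)) r = Lp_norm (leb (2 * n)) q (f j)"
    if j: "j \<in> J" for j
  proof -
    have "(\<integral>\<^sup>+p. \<phi> j p \<partial>(PL (J - {j}) \<Otimes>\<^sub>M lborel)) = (\<integral>\<^sup>+x. ennreal_powr (g j x) q \<partial>PL J)"
      unfolding \<phi>_def J_def using j g(1)[OF j] unfolding J_def
      by (intro nn_integral_insert_last borel_measurable_ennreal_powr)
    also have "\<dots> = (\<integral>\<^sup>+x. ennreal_powr (f j x) q \<partial>PL J)"
      using g(3)[OF j] by (intro nn_integral_cong_AE) (auto elim: eventually_mono)
    finally show ?thesis
      by (simp add: Lp_norm_def leb_def nn_integral_completion qr J_def)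
  qed
  define G where "G p = (\<Prod>j\<in>J. g j (rho n h j p))" for p
  have G_eq: "G (x(2 * n + 1 := t)) = (\<Prod>j\<in>J. ennreal_powr (\<phi> j (restrict x (J - {j}), t + h j x)) r)"
    if "x \<in> space (PL J)" for x t
    unfolding G_def \<phi>_def ennreal_powr_powr qr ennreal_powr_1
    using that unfolding J_def by (intro prod.cong refl) (simp only: rho_eq_insert_last)
  have ins: "{1..2 * n + 1} = insert (2 * n + 1) J" by (auto simp: J_def)
  \<comment> \<open>Needed to split the integral into one over \<open>x\<close> and one over
    \<open>t\<close>; it comes from \<open>rho\<close> being Borel measurable into
    \<open>PL J\<close>, where the majorants are Borel.\<close>
  have G: "G \<in> borel_measurable (PL (insert (2 * n + 1) J))"
    unfolding G_def
  proof (rule borel_measurable_prod_ennreal)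
    fix j assume j: "j \<in> J"
    note [measurable] = h[OF j]
    have [measurable]: "(\<lambda>p. restrict p J) \<in> PL (insert (2 * n + 1) J) \<rightarrow>\<^sub>M PL J"
      "(\<lambda>p. restrict p (J - {j})) \<in> PL (insert (2 * n + 1) J) \<rightarrow>\<^sub>M PL (J - {j})"
      by (intro measurable_restrict_subset; auto)+
    have "(\<lambda>p. (restrict p (J - {j}), p (2 * n + 1) + h j (restrict p J)))
        \<in> PL (insert (2 * n + 1) J) \<rightarrow>\<^sub>M PL (J - {j}) \<Otimes>\<^sub>M lborel"
      by measurable
    from measurable_compose[OF this insert_last_measurable[of j "2 * n", folded J_def, OF j]]
    have "(\<lambda>p. insert_last (2 * n) j (restrict p (J - {j}), p (2 * n + 1) + h j (restrict p J)))
        \<in> PL (insert (2 * n + 1) J) \<rightarrow>\<^sub>M PL J" .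
    moreover have "rho n h j p = insert_last (2 * n) j (restrict p (J - {j}), p (2 * n + 1) + h j (restrict p J))"
      if "p \<in> space (PL (insert (2 * n + 1) J))" for p
    proof -
      have "p = (restrict p J)(2 * n + 1 := p (2 * n + 1))"
        using that by (auto simp: space_PiM PiE_iff extensional_def fun_eq_iff restrict_def)
      moreover have "restrict p J \<in> space (PL {1..2 * n})" by (simp add: space_PiM J_def)
      moreover have "restrict (restrict p J) (J - {j}) = restrict p (J - {j})"
        by (auto simp: restrict_def fun_eq_iff)
      ultimately show ?thesis
        using rho_eq_insert_last[of j n "restrict p J" h "p (2 * n + 1)"] j by (simp add: J_def)
    qed
    ultimately have "rho n h j \<in> PL (insert (2 * n + 1) J) \<rightarrow>\<^sub>M PL J"
      by (subst measurable_cong) auto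
    then show "(\<lambda>p. g j (rho n h j p)) \<in> borel_measurable (PL (insert (2 * n + 1) J))"
      by (rule measurable_compose[OF _ g(1)[OF j]])
  qed
  \<comment> \<open>A pointwise comparison: here the composites of \<open>f j\<close> with
    \<open>rho\<close>, whose measurability has not been established, are traded for Borel
    ones.\<close>
  have "(\<integral>\<^sup>+p. (\<Prod>j\<in>J. f j (rho n h j p)) \<partial>leb (2 * n + 1)) \<le> (\<integral>\<^sup>+p. G p \<partial>leb (2 * n + 1))"
    unfolding G_def
  proof (intro nn_integral_mono prod_mono_ennreal g(2))
    show "rho n h j p \<in> space (PL J)" for j p
      unfolding J_def using assms(1) by (intro rho_space) simp
  qed
  also have "\<dots> = (\<integral>\<^sup>+p. G p \<partial>PL (insert (2 * n + 1) J))"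
    by (simp only: leb_def nn_integral_completion ins)
  also have "\<dots> = (\<integral>\<^sup>+x. \<integral>\<^sup>+t. G (x(2 * n + 1 := t)) \<partial>lborel \<partial>PL J)"
    using G by (intro PL.product_nn_integral_insert) (auto simp: J_def)
  also have "\<dots> = (\<integral>\<^sup>+x. \<integral>\<^sup>+t. (\<Prod>j\<in>J. ennreal_powr (\<phi> j (restrict x (J - {j}), t + h j x)) r) \<partial>lborel \<partial>PL J)"
    by (intro nn_integral_cong) (simp only: G_eq)
  also have "\<dots> \<le> max 1 C * (\<Prod>j\<in>J. ennreal_powr (\<integral>\<^sup>+p. \<phi> j p \<partial>(PL (J - {j}) \<Otimes>\<^sub>M lborel)) r)"
    unfolding J_def r_def
  proof (rule averaged_estimate)
    show "plane_estimate (max 1 C) (\<lambda>(u, s). h k (z(k := u, n + k := s))) (\<lambda>(u, s). h (n + k) (z(k := u, n + k := s)))"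
      if "k \<in> {1..n}" "z \<in> coord_space ({1..2 * n} - {k, n + k})" for k z
      using L3 h[unfolded J_def] that assms(2) by (intro L32_L3_property_plane_estimate) simp_all
  qed (use assms(1) h[unfolded J_def] \<phi>[unfolded J_def] in simp_all)
  also have "\<dots> = max 1 C * (\<Prod>j\<in>J. Lp_norm (leb (2 * n)) q (f j))"
    by (simp add: norm)
  finally show "(\<integral>\<^sup>+ p. (\<Prod>j\<in>{1..2 * n}. f j (rho n h j p)) \<partial>leb (2 * n + 1))
      \<le> max 1 C * (\<Prod>j\<in>{1..2 * n}. Lp_norm (leb (2 * n)) (real (n * (2 * n + 1)) / real (n + 1)) (f j))"
    by (simp only: J_def q_def)
qed

end
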